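(* Let $P,Q$ be two curves in $\mathbb{R}^d$ with $m_1$ and $m_2$ vertices, respectively, and let $m=\min\{m_1,m_2\}$. Let $w\ge 1$ and $\ell\ge 1$ be integers, $r>0$, $\delta=4dr\ell$, and $c=4d^{3/2}\ell$. With probabilities taken over the random choice of $t,r_P,r_Q$ in the bounded-speed hashing scheme, it holds that: (i) if $d_{w,\mathrm{sF}}(P,Q)<r$, then $\Pr\left(g^{t,r_P}_{w,\delta,\ell}(P)=g^{t,r_Q}_{w,\delta,\ell}(Q)\right)>\left(\frac{1}{\sqrt2\,w\ell}\right)^{2m/\ell}$; (ii) if $d_{w\ell,\mathrm{sF}}(P,Q)>cr$, then $\Pr\left(g^{t,r_P}_{w,\delta,\ell}(P)=g^{t,r_Q}_{w,\delta,\ell}(Q)\right)=0$.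
   Context: A curve in $\mathbb{R}^d$ is given by its finite sequence of vertices $P=p_1,\dots,p_m\in\mathbb{R}^d$, $m\geq 1$. Given curves $P=p_1,\dots,p_{m_1}$ and $Q=q_1,\dots,q_{m_2}$, a traversal is a sequence of index pairs $T=(i_1,j_1),\dots,(i_\ell,j_\ell)$ with $(i_1,j_1)=(1,1)$, $(i_\ell,j_\ell)=(m_1,m_2)$, and, for every $k<\ell$, $i_{k+1}-i_k\in\{0,1\}$, $j_{k+1}-j_k\in\{0,1\}$ and $(i_{k+1}-i_k)+(j_{k+1}-j_k)\ge 1$. A traversal is a $w$-speed traversal if each vertex of either curve is paired with at most $w$ vertices of the other curve. For curves with $1/w\le m_1/m_2\le w$, the $w$-speed discrete Fréchet distance is $d_{w,\mathrm{sF}}(P,Q)=\min_T\max_{(i,j)\in T}\|p_i-q_j\|$ over all $w$-speed traversals $T$, with $\|\cdot\|$ the Euclidean norm (the distance is considered only for curves satisfying this length condition, so this condition is implicit whenever the distance is mentioned). Basic hash function: for $\delta>0$ let $G_\delta=\{(x_1,\dots,x_d): x_i\in\delta\mathbb{Z}\ \forall i\}$ and, for $t\in[0,\delta)^d$, $\widehat G^t_\delta=\{p+t: p\in G_\delta\}$. For a curve $P=p_1,\dots,p_m$, the curve $h^t_\delta(P)$ is obtained by (1) replacing each vertex $p_i$ by its closest point $p_i'$ of $\widehat G^t_\delta$ (ties broken by a fixed rule, say the lexicographically smallest closest point), and (2) removing consecutive duplicates, i.e., removing $p_i'$ whenever it is identical to $p_{i-1}'$. Bounded-speed hashing scheme: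 let $t=t_1,t_2,\dots$ be independent and uniform in $[0,\delta)^d$, and let $r_P=r_{P,1},r_{P,2},\dots$ and $r_Q=r_{Q,1},r_{Q,2},\dots$ be sequences of independent random integers uniform in $[1,w\ell]$; $t,r_P,r_Q$ are mutually independent. A curve $P=p_1,\dots,p_m$ is partitioned into non-overlapping consecutive subsequences $(\widehat P_1,\dots,\widehat P_K)$, $\widehat P_i=p_{s_{i-1}+1},\dots,p_{s_i}$, whose lengths are given by $r_P$: $s_0=0$, $s_i=\min\{\sum_{j=1}^{i}r_{P,j},\,m\}$, and $K$ is the first index with $s_K=m$ (so the last subsequence is truncated at $p_m$). The hash value is the array of curves $g^{t,r_P}_{w,\delta,\ell}(P)=\left(h^{t_1}_\delta(\widehat P_1),\dots,h^{t_K}_\delta(\widehat P_K)\right)$. The query curve $Q$ is hashed in the same way, using the same $t$ but the sequence $r_Q$ instead of $r_P$. Two hash values are equal only if the arrays have the same length and coincide in each position. *)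

theory Defs
  imports "HOL-Probability.Probability"
begin

section \<open>Speed-bounded discrete Frechet distance\<close>

text \<open>A curve is the list of its vertices. Indices start at 0, so a traversal of curves with
  \<open>m1\<close> and \<open>m2\<close> vertices leads from \<open>(0, 0)\<close> to \<open>(m1 - 1, m2 - 1)\<close>.\<close>

definition traversal :: "nat \<Rightarrow> nat \<Rightarrow> (nat \<times> nat) list \<Rightarrow> bool" where
  "traversal m1 m2 T \<longleftrightarrow>
     T \<noteq> [] \<and> hd T = (0, 0) \<and> last T = (m1 - 1, m2 - 1) \<and>
     successively (\<lambda>(i, j) (i', j').
       i' \<in> {i, i + 1} \<and> j' \<in> {j, j + 1} \<and> (i', j') \<noteq> (i, j)) T"

definition speed_traversal :: "nat \<Rightarrow> nat \<Rightarrow> nat \<Rightarrow> (nat \<times> nat) list \<Rightarrow> bool" where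
  "speed_traversal w m1 m2 T \<longleftrightarrow>
     traversal m1 m2 T \<and>
     (\<forall>i<m1. card {j. (i, j) \<in> set T} \<le> w) \<and>
     (\<forall>j<m2. card {i. (i, j) \<in> set T} \<le> w)"

definition speed_compatible :: "nat \<Rightarrow> 'a list \<Rightarrow> 'a list \<Rightarrow> bool" where
  "speed_compatible w P Q \<longleftrightarrow>
     1 / real w \<le> real (length P) / real (length Q) \<and>
     real (length P) / real (length Q) \<le> real w"

text \<open>Meaningful only for nonempty \<open>P\<close>, \<open>Q\<close> with \<open>speed_compatible w P Q\<close>: nonempty curves
  violating this condition have no \<open>w\<close>-speed traversal, and the minimum is unspecified.\<close>

definition speed_frechet :: "nat \<Rightarrow> 'a::real_normed_vector list \<Rightarrow> 'a list \<Rightarrow> real" where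
  "speed_frechet w P Q =
     Min ((\<lambda>T. Max ((\<lambda>(i, j). norm (P ! i - Q ! j)) ` set T)) `
       {T. speed_traversal w (length P) (length Q) T})"

section \<open>Basic hash function\<close>

text \<open>The linear order on the index type enumerates the coordinates and is used only for the
  lexicographic order on points.\<close>

definition lex_le :: "real ^ 'n::{finite, linorder} \<Rightarrow> real ^ 'n::{finite, linorder} \<Rightarrow> bool" where
  "lex_le x y \<longleftrightarrow> x = y \<or> (\<exists>k. x $ k < y $ k \<and> (\<forall>i<k. x $ i = y $ i))"

definition shifted_grid :: "real \<Rightarrow> real ^ 'n::finite \<Rightarrow> (real ^ 'n::finite) set" where
  "shifted_grid \<delta> t = {p + t | p. \<forall>i. \<exists>z::int. p $ i = \<delta> * of_int z}"

definition closest_grid_points ::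
    "real \<Rightarrow> real ^ 'n::finite \<Rightarrow> real ^ 'n::finite \<Rightarrow> (real ^ 'n::finite) set" where
  "closest_grid_points \<delta> t p =
     {x \<in> shifted_grid \<delta> t. \<forall>y \<in> shifted_grid \<delta> t. norm (p - x) \<le> norm (p - y)}"

definition snap ::
    "real \<Rightarrow> real ^ 'n::{finite, linorder} \<Rightarrow> real ^ 'n::{finite, linorder}
      \<Rightarrow> real ^ 'n::{finite, linorder}" where
  "snap \<delta> t p =
     (THE x. x \<in> closest_grid_points \<delta> t p \<and> (\<forall>y \<in> closest_grid_points \<delta> t p. lex_le x y))"

definition basic_hash ::
    "real \<Rightarrow> real ^ 'n::{finite, linorder} \<Rightarrow> (real ^ 'n::{finite, linorder}) list
      \<Rightarrow> (real ^ 'n::{finite, linorder}) list" where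
  "basic_hash \<delta> t P = remdups_adj (map (snap \<delta> t) P)"

section \<open>Bounded-speed hashing scheme\<close>

text \<open>The random sequences are indexed from 0, so piece \<open>i\<close> consists of the vertices at positions
  \<open>breakpoint \<rho> m i, \<dots>, breakpoint \<rho> m (i + 1) - 1\<close>.\<close>

definition breakpoint :: "(nat \<Rightarrow> nat) \<Rightarrow> nat \<Rightarrow> nat \<Rightarrow> nat" where
  "breakpoint \<rho> m i = min (\<Sum>j<i. \<rho> j) m"

definition num_pieces :: "(nat \<Rightarrow> nat) \<Rightarrow> nat \<Rightarrow> nat" where
  "num_pieces \<rho> m = (LEAST k. breakpoint \<rho> m k = m)"

definition piece :: "(nat \<Rightarrow> nat) \<Rightarrow> 'a list \<Rightarrow> nat \<Rightarrow> 'a list" where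
  "piece \<rho> P i = nths P {breakpoint \<rho> (length P) i ..< breakpoint \<rho> (length P) (i + 1)}"

definition speed_hash ::
    "real \<Rightarrow> (nat \<Rightarrow> real ^ 'n::{finite, linorder}) \<Rightarrow> (nat \<Rightarrow> nat)
      \<Rightarrow> (real ^ 'n::{finite, linorder}) list
      \<Rightarrow> (real ^ 'n::{finite, linorder}) list list" where
  "speed_hash \<delta> t \<rho> P =
     map (\<lambda>i. basic_hash \<delta> (t i) (piece \<rho> P i)) [0..<num_pieces \<rho> (length P)]"

text \<open>Joint law of \<open>(t, r\<^sub>P, r\<^sub>Q)\<close>; the product measure encodes all the independence requirements.\<close>

definition scheme_space ::
    "real \<Rightarrow> nat \<Rightarrow> nat
      \<Rightarrow> ((nat \<Rightarrow> real ^ 'n::finite) \<times> (nat \<Rightarrow> nat) \<times> (nat \<Rightarrow> nat)) measure" where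
  "scheme_space \<delta> w l =
     (\<Pi>\<^sub>M k\<in>UNIV. uniform_measure lborel {x. \<forall>i. 0 \<le> x $ i \<and> x $ i < \<delta>}) \<Otimes>\<^sub>M
     (\<Pi>\<^sub>M k\<in>UNIV. uniform_count_measure {1..w * l}) \<Otimes>\<^sub>M
     (\<Pi>\<^sub>M k\<in>UNIV. uniform_count_measure {1..w * l})"

end

theory Submission
  imports Defs
begin

text \<open>The snap of \<open>p\<close> depends only on its integer grid cell, so equal hashes align the pieces of both
  curves run by run. Each run lies in one cell of diameter \<open>\<surd>d \<delta> = c r\<close> and each piece has at most
  \<open>w l\<close> vertices, so a traversal inside the pieces is \<open>w l\<close>-speed and has cost at most \<open>c r\<close>.

  For the lower bound, a \<open>w\<close>-speed traversal of cost \<open>D < r\<close> is thinned to a sequence of stars: blocks of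
  consecutive vertices with a single vertex on one side and at most \<open>w\<close> on the other. There are at
  most \<open>m\<close> stars. Cut the sequence into chunks of \<open>l\<close> stars, the last one possibly shorter. A shift
  separates a given star with probability at most \<open>2 d D / \<delta> < 1 / (2 l)\<close>, and a chunk of \<open>s = x l\<close> stars
  has at most \<open>x w l\<close> vertices on each side. The last piece only has to be long enough, so in every
  chunk the random choices succeed with probability above
  \<open>(1 - x / 2) (1 - x + x / (w l))\<^sup>2\<close>, and the weighted arithmetic-geometric mean inequality bounds this
  from below by \<open>(1 / (2 w\<^sup>2 l\<^sup>2))\<close> to the power \<open>x\<close>. The exponents add up to at most \<open>m / l\<close>.\<close>

section \<open>Couplings of curves\<close>

definition monotone_step :: "nat \<times> nat \<Rightarrow> nat \<times> nat \<Rightarrow> bool" where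
  "monotone_step = (\<lambda>(i, j) (i', j'). i' \<in> {i, i + 1} \<and> j' \<in> {j, j + 1} \<and> (i', j') \<noteq> (i, j))"

lemma traversal_iff:
  "traversal m1 m2 T \<longleftrightarrow>
     T \<noteq> [] \<and> hd T = (0, 0) \<and> last T = (m1 - 1, m2 - 1) \<and> successively monotone_step T"
  by (simp add: traversal_def monotone_step_def)

text \<open>A single step is not a transitive relation, but the componentwise order without equality
  is. Passing to it turns a condition on neighbours into one on all pairs, from which the index
  bounds and distinctness are read off.\<close>

lemma monotone_steps_sorted:
  assumes "successively monotone_step T"
  shows "sorted_wrt (\<lambda>x y. fst x \<le> fst y \<and> snd x \<le> snd y \<and> x \<noteq> y) T"
proof -
  have "transp (\<lambda>x y::nat \<times> nat. fst x \<le> fst y \<and> snd x \<le> snd y \<and> x \<noteq> y)"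
    by (rule transpI) (auto simp: prod_eq_iff)
  moreover have "successively (\<lambda>x y. fst x \<le> fst y \<and> snd x \<le> snd y \<and> x \<noteq> y) T"
    by (rule successively_mono[OF assms]) (auto simp: monotone_step_def)
  ultimately show ?thesis
    by (simp add: successively_conv_sorted_wrt)
qed

lemma traversal_bounds:
  assumes "traversal m1 m2 T" "(i, j) \<in> set T"
  shows "i \<le> m1 - 1" "j \<le> m2 - 1"
proof -
  have T: "T = butlast T @ [(m1 - 1, m2 - 1)]"
    using assms(1) by (metis append_butlast_last_id traversal_iff)
  have "sorted_wrt (\<lambda>x y. fst x \<le> fst y \<and> snd x \<le> snd y \<and> x \<noteq> y) T"
    using assms(1) monotone_steps_sorted traversal_iff by blast
  then have "\<forall>x \<in> set (butlast T). fst x \<le> m1 - 1 \<and> snd x \<le> m2 - 1"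
    by (subst (asm) T) (auto simp: sorted_wrt_append)
  moreover have "(i, j) \<in> set (butlast T) \<or> (i, j) = (m1 - 1, m2 - 1)"
    using assms(2) by (subst (asm) T) auto
  ultimately show "i \<le> m1 - 1" "j \<le> m2 - 1" by auto
qed

lemma traversal_distinct:
  assumes "traversal m1 m2 T"
  shows "distinct T"
proof -
  have "sorted_wrt (\<lambda>x y. fst x \<le> fst y \<and> snd x \<le> snd y \<and> x \<noteq> y) T"
    using assms monotone_steps_sorted traversal_iff by blast
  then have "sorted_wrt (\<noteq>) T"
    by (rule sorted_wrt_mono_rel[rotated]) auto
  then show ?thesis by (auto simp: sorted_wrt_iff_nth_less distinct_conv_nth) (metis nat_neq_iff)
qed

text \<open>Bounds and distinctness confine a traversal to the repetition-free lists over a finite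
  box. This makes the \<open>Min\<close> in \<open>speed_frechet\<close> a minimum over a finite
  set.\<close>

lemma finite_traversals: "finite {T. traversal m1 m2 T}"
proof (rule finite_subset)
  show "{T. traversal m1 m2 T} \<subseteq> {T. set T \<subseteq> {..m1 - 1} \<times> {..m2 - 1} \<and> distinct T}"
    using traversal_bounds traversal_distinct by (auto simp: subset_iff)
qed (rule finite_subset_distinct, simp)

lemma traversal_swap:
  assumes "traversal m1 m2 T"
  shows "traversal m2 m1 (map prod.swap T)"
  using assms
  by (auto simp: traversal_iff successively_map hd_map last_map monotone_step_def
      elim!: successively_mono)

text \<open>The two paths are linked by the diagonal step from \<open>(m1 - 1, m2 - 1)\<close> to
  \<open>(m1, m2)\<close>; positive sizes keep the truncated subtraction exact.\<close>

lemma traversal_append: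
  assumes "traversal m1 m2 T" "traversal n1 n2 T'" "m1 > 0" "m2 > 0" "n1 > 0" "n2 > 0"
  shows "traversal (m1 + n1) (m2 + n2) (T @ map (\<lambda>(i, j). (m1 + i, m2 + j)) T')"
  using assms
  by (auto simp: traversal_iff successively_append_iff successively_map hd_map last_map
      monotone_step_def elim!: successively_mono)

lemma traversal_rectangle:
  assumes "a > 0" "b > 0"
  shows "traversal a b (map (\<lambda>i. (i, 0)) [0..<a] @ map (\<lambda>j. (a - 1, j)) [1..<b])"
proof -
  have S: "successively (\<lambda>i j. j = Suc i) [m..<n]" for m n
    by (simp add: successively_conv_nth)
  have "successively monotone_step (map (\<lambda>i. (i, 0)) [0..<a])"
    "successively monotone_step (map (\<lambda>j. (a - 1, j)) [1..<b])"
    unfolding successively_map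
    by (rule successively_mono[OF S], simp add: monotone_step_def)+
  then show ?thesis
    using assms
    by (cases "b = 1") (auto simp: traversal_iff successively_append_iff hd_map last_map hd_append
        monotone_step_def)
qed

section \<open>Couplings that respect a relation\<close>

text \<open>\<open>R\<close> will be closeness, equality of grid cells or no constraint at all, so
  that one calculus serves the cost, the hash and the mere existence of a traversal.\<close>

definition coupled :: "nat \<Rightarrow> ('a \<Rightarrow> 'b \<Rightarrow> bool) \<Rightarrow> 'a list \<Rightarrow> 'b list \<Rightarrow> bool" where
  "coupled w R A B \<longleftrightarrow>
     (\<exists>T. speed_traversal w (length A) (length B) T \<and> (\<forall>(i, j) \<in> set T. R (A ! i) (B ! j)))"

text \<open>Nonempty lists guarantee that the paired entries are members of the lists: every
  traversal contains \<open>(0, 0)\<close>, which is out of range in an empty list.\<close>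

lemma coupled_mono:
  assumes "coupled w R A B" "A \<noteq> []" "B \<noteq> []"
    and "\<And>x y. x \<in> set A \<Longrightarrow> y \<in> set B \<Longrightarrow> R x y \<Longrightarrow> S x y"
  shows "coupled w S A B"
proof -
  obtain T where T: "speed_traversal w (length A) (length B) T" "\<forall>(i, j) \<in> set T. R (A ! i) (B ! j)"
    using assms(1) by (auto simp: coupled_def)
  have "S (A ! i) (B ! j)" if "(i, j) \<in> set T" for i j
  proof -
    have "i \<le> length A - 1" "j \<le> length B - 1"
      using T(1) traversal_bounds[OF _ that] by (auto simp: speed_traversal_def)
    moreover have "length A > 0" "length B > 0" using assms(2,3) by simp_all
    ultimately have "i < length A" "j < length B" by linarith+
    then show ?thesis
      using T(2) that assms(4) by fastforce
  qed
  then show ?thesis using T(1) by (auto simp: coupled_def)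
qed

lemma coupled_swap:
  assumes "coupled w R A B"
  shows "coupled w (\<lambda>y x. R x y) B A"
proof -
  obtain T where T: "speed_traversal w (length A) (length B) T" "\<forall>(i, j) \<in> set T. R (A ! i) (B ! j)"
    using assms by (auto simp: coupled_def)
  have "(x, y) \<in> set (map prod.swap T) \<longleftrightarrow> (y, x) \<in> set T" for x y
    by force
  then have "speed_traversal w (length B) (length A) (map prod.swap T)"
    using T(1) traversal_swap by (auto simp only: speed_traversal_def)
  moreover have "\<forall>(j, i) \<in> set (map prod.swap T). R (A ! i) (B ! j)"
    using T(2) by auto
  ultimately show ?thesis by (auto simp only: coupled_def)
qed

text \<open>When every pair is admissible, any traversal will do, and the list lengths alone bound
  the number of partners.\<close>

lemma coupled_rectangle:
  assumes "A \<noteq> []" "B \<noteq> []" "length A \<le> w" "length B \<le> w"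
    and "\<And>x y. x \<in> set A \<Longrightarrow> y \<in> set B \<Longrightarrow> R x y"
  shows "coupled w R A B"
proof -
  define T where "T = map (\<lambda>i. (i, 0)) [0..<length A] @ map (\<lambda>j. (length A - 1, j)) [1..<length B]"
  have T: "traversal (length A) (length B) T"
    unfolding T_def using assms by (intro traversal_rectangle) auto
  have bound: "i < length A" "j < length B" if "(i, j) \<in> set T" for i j
    using that assms(1,2) by (auto simp: T_def)
  have "card {j. (i, j) \<in> set T} \<le> w" for i
    using bound card_mono[of "{..<length B}" "{j. (i, j) \<in> set T}"] assms(4) by fastforce
  moreover have "card {i. (i, j) \<in> set T} \<le> w" for j
    using bound card_mono[of "{..<length A}" "{i. (i, j) \<in> set T}"] assms(3) by fastforce
  moreover have "\<forall>(i, j) \<in> set T. R (A ! i) (B ! j)"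
    using bound assms(5) by auto
  ultimately show ?thesis
    using T by (auto simp: coupled_def speed_traversal_def)
qed

text \<open>Both index ranges of the second traversal are moved past those of the first. The union
  is block diagonal, so no vertex gains partners and the two halves are counted separately.\<close>

lemma coupled_append:
  assumes "coupled w R A B" "coupled w R A' B'" "A \<noteq> []" "B \<noteq> []" "A' \<noteq> []" "B' \<noteq> []"
  shows "coupled w R (A @ A') (B @ B')"
proof -
  obtain T where T: "traversal (length A) (length B) T"
      "\<And>i. i < length A \<Longrightarrow> card {j. (i, j) \<in> set T} \<le> w"
      "\<And>j. j < length B \<Longrightarrow> card {i. (i, j) \<in> set T} \<le> w"
      "\<And>i j. (i, j) \<in> set T \<Longrightarrow> R (A ! i) (B ! j)"
    using assms(1) by (fastforce simp: coupled_def speed_traversal_def)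
  obtain T' where T': "traversal (length A') (length B') T'"
      "\<And>i. i < length A' \<Longrightarrow> card {j. (i, j) \<in> set T'} \<le> w"
      "\<And>j. j < length B' \<Longrightarrow> card {i. (i, j) \<in> set T'} \<le> w"
      "\<And>i j. (i, j) \<in> set T' \<Longrightarrow> R (A' ! i) (B' ! j)"
    using assms(2) by (fastforce simp: coupled_def speed_traversal_def)
  define U where "U = T @ map (\<lambda>(i, j). (length A + i, length B + j)) T'"
  have bound: "i < length A" "j < length B" if "(i, j) \<in> set T" for i j
  proof -
    have "length A > 0" "length B > 0" using assms(3,4) by simp_all
    then show "i < length A" "j < length B"
      using traversal_bounds[OF T(1) that] by linarith+
  qed
  have U: "traversal (length (A @ A')) (length (B @ B')) U"
    unfolding U_def length_append using T(1) T'(1) assms by (intro traversal_append) auto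
  have U_iff: "(i, j) \<in> set U \<longleftrightarrow>
      (i, j) \<in> set T \<or> length A \<le> i \<and> length B \<le> j \<and> (i - length A, j - length B) \<in> set T'" for i j
    by (force simp: U_def)
  have "card {j. (i, j) \<in> set U} \<le> w" if "i < length (A @ A')" for i
  proof (cases "i < length A")
    case True
    then have "{j. (i, j) \<in> set U} = {j. (i, j) \<in> set T}" by (auto simp: U_def)
    then show ?thesis using T(2) True by simp
  next
    case False
    then have "{j. (i, j) \<in> set U} = (+) (length B) ` {j. (i - length A, j) \<in> set T'}"
      by (force simp: U_iff dest: bound intro: image_eqI[of _ _ "_ - length B"])
    then show ?thesis using T'(2)[of "i - length A"] False that by (simp add: card_image)
  qed
  moreover have "card {i. (i, j) \<in> set U} \<le> w" if "j < length (B @ B')" for j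
  proof (cases "j < length B")
    case True
    then have "{i. (i, j) \<in> set U} = {i. (i, j) \<in> set T}" by (auto simp: U_def)
    then show ?thesis using T(3) True by simp
  next
    case False
    then have "{i. (i, j) \<in> set U} = (+) (length A) ` {i. (i, j - length B) \<in> set T'}"
      by (force simp: U_iff dest: bound intro: image_eqI[of _ _ "_ - length A"])
    then show ?thesis using T'(3)[of "j - length B"] False that by (simp add: card_image)
  qed
  moreover have "\<forall>(i, j) \<in> set U. R ((A @ A') ! i) ((B @ B') ! j)"
    using T(4) T'(4) by (auto simp: U_def nth_append dest: bound)
  ultimately show ?thesis
    using U by (auto simp: coupled_def speed_traversal_def)
qed

lemma coupled_concat:
  assumes "length As = length Bs" "As \<noteq> []"
    and "\<And>k. k < length As \<Longrightarrow> As ! k \<noteq> [] \<and> Bs ! k \<noteq> [] \<and> coupled w R (As ! k) (Bs ! k)"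
  shows "coupled w R (concat As) (concat Bs)"
  using assms
proof (induction As Bs rule: list_induct2)
  case (Cons A As B Bs)
  have 1: "A \<noteq> []" "B \<noteq> []" "coupled w R A B"
    using Cons.prems(2)[of 0] by auto
  have 2: "As ! k \<noteq> [] \<and> Bs ! k \<noteq> [] \<and> coupled w R (As ! k) (Bs ! k)" if "k < length As" for k
    using Cons.prems(2)[of "Suc k"] that by auto
  show ?case
  proof (cases "As = []")
    case True
    then show ?thesis using 1 Cons.hyps by simp
  next
    case False
    moreover have "concat As \<noteq> []" "concat Bs \<noteq> []"
      unfolding concat_eq_Nil_conv using 2[of 0] False Cons.hyps
      by (metis length_0_conv length_greater_0_conv nth_mem)+
    ultimately show ?thesis using coupled_append[OF 1(3) Cons.IH] 1(1,2) 2 by simp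
  qed
qed simp

text \<open>Equal sequences after duplicate removal mean that the maximal runs of \<open>A\<close>
  and \<open>B\<close> correspond one to one with equal values. Corresponding runs are coupled by
  rectangles; a run is no longer than its list, hence the speed bound.\<close>

lemma coupled_runs:
  assumes "remdups_adj (map f A) = remdups_adj (map g B)" "A \<noteq> []"
    and "length A \<le> w" "length B \<le> w"
  shows "coupled w (\<lambda>x y. f x = g y) A B"
  using assms
proof (induction "length A" arbitrary: A B rule: less_induct)
  case less
  obtain x A0 where A: "A = x # A0" using less.prems by (cases A) auto
  obtain y B0 where B: "B = y # B0" using less.prems A by (cases B) auto
  define A1 A2 where "A1 = takeWhile (\<lambda>z. f z = f x) A0" and "A2 = dropWhile (\<lambda>z. f z = f x) A0"
  define B1 B2 where "B1 = takeWhile (\<lambda>z. g z = g y) B0" and "B2 = dropWhile (\<lambda>z. g z = g y) B0"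
  have split: "A = (x # A1) @ A2" "B = (y # B1) @ B2"
    by (simp_all add: A B A1_def A2_def B1_def B2_def)
  have eq: "f x = g y" "remdups_adj (map f A2) = remdups_adj (map g B2)"
    using less.prems(1) by (auto simp: A B A2_def B2_def remdups_adj_Cons' dropWhile_map o_def)
  have 1: "coupled w (\<lambda>x y. f x = g y) (x # A1) (y # B1)"
  proof (rule coupled_rectangle)
    show "f u = g v" if "u \<in> set (x # A1)" "v \<in> set (y # B1)" for u v
      using that eq(1) by (auto simp: A1_def B1_def dest!: set_takeWhileD)
  qed (use less.prems split in auto)
  show ?case
  proof (cases "A2 = []")
    case True
    then have "B2 = []" using eq(2)[symmetric] by simp
    then show ?thesis using 1 True split by simp
  next
    case False
    then have "B2 \<noteq> []" using eq(2) by auto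
    moreover have "coupled w (\<lambda>x y. f x = g y) A2 B2"
      by (rule less.hyps) (use less.prems split eq False in auto)
    ultimately show ?thesis using coupled_append[OF 1] False split by simp
  qed
qed

section \<open>Existence of speed-bounded traversals and attainment of the distance\<close>

text \<open>Greedy construction: each vertex of the shorter list takes a block of consecutive
  vertices of the longer one.\<close>

lemma coupled_by_length:
  assumes "A \<noteq> []" "length A \<le> length B" "length B \<le> w * length A"
  shows "coupled w (\<lambda>_ _. True) A B"
  using assms
proof (induction A arbitrary: B)
  case (Cons x A)
  have "w > 0" using Cons.prems by (cases w) auto
  show ?case
  proof (cases "A = []")
    case True
    show ?thesis by (rule coupled_rectangle) (use Cons.prems True \<open>w > 0\<close> in auto)
  next
    case False
    \<comment> \<open>As many vertices as the speed allows, while at least one vertex of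
      \<open>B\<close> is left for each remaining vertex of \<open>A\<close>.\<close>
    define b where "b = min w (length B - length A)"
    have "1 \<le> length A" using False by (simp add: Suc_le_eq)
    moreover have "length A \<le> w * length A" using \<open>w > 0\<close> by simp
    moreover have "length A < length B" "length B \<le> w * length A + w" using Cons.prems by simp_all
    ultimately have b: "b > 0" "b \<le> w" "b < length B" "length A + b \<le> length B" "length B \<le> w * length A + b"
      using \<open>w > 0\<close> unfolding b_def by linarith+
    have 1: "coupled w (\<lambda>_ _. True) [x] (take b B)"
      by (rule coupled_rectangle) (use b \<open>w > 0\<close> in auto)
    have 2: "coupled w (\<lambda>_ _. True) A (drop b B)"
      by (rule Cons.IH) (use b False in auto)
    show ?thesis
      using coupled_append[OF 1 2] b False by (cases B) auto
  qed
qed simp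

text \<open>With denominators cleared, the length condition says that each length is at most
  \<open>w\<close> times the other; the greedy construction then applies with the shorter curve in
  first place.\<close>

lemma speed_traversal_exists:
  assumes "P \<noteq> []" "Q \<noteq> []" "speed_compatible w P Q" "w \<ge> 1"
  shows "\<exists>T. speed_traversal w (length P) (length Q) T"
proof -
  have pos: "0 < real (length P)" "0 < real (length Q)" "0 < real w" using assms by auto
  have "real (length Q) \<le> real (w * length P)" "real (length P) \<le> real (w * length Q)"
    using assms(3) pos unfolding speed_compatible_def by (auto simp: field_simps)
  then have len: "length Q \<le> w * length P" "length P \<le> w * length Q"
    unfolding of_nat_le_iff by auto
  show ?thesis
  proof (cases "length P \<le> length Q")
    case True
    then show ?thesis using coupled_by_length[of P Q w] assms len by (auto simp: coupled_def)
  next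
    case False
    then show ?thesis using coupled_swap[OF coupled_by_length[of Q P w]] assms len
      by (auto simp: coupled_def)
  qed
qed

lemma speed_frechet_le:
  assumes "coupled w (\<lambda>x y. norm (x - y) \<le> D) P Q"
  shows "speed_frechet w P Q \<le> D"
proof -
  let ?cost = "\<lambda>T. Max ((\<lambda>(i, j). norm (P ! i - Q ! j)) ` set T)"
  obtain T where T: "speed_traversal w (length P) (length Q) T"
      "\<forall>(i, j) \<in> set T. norm (P ! i - Q ! j) \<le> D"
    using assms by (auto simp: coupled_def)
  have "finite {T. speed_traversal w (length P) (length Q) T}"
    by (rule finite_subset[OF _ finite_traversals]) (auto simp: speed_traversal_def)
  then have "speed_frechet w P Q \<le> ?cost T"
    unfolding speed_frechet_def using T(1) by (intro Min_le) auto
  also have "\<dots> \<le> D"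
    using T by (subst Max_le_iff) (auto simp: speed_traversal_def traversal_iff)
  finally show ?thesis .
qed

text \<open>A minimum over a finite nonempty set is attained; nonemptiness is where the length
  condition enters.\<close>

lemma speed_frechet_attained:
  assumes "P \<noteq> []" "Q \<noteq> []" "speed_compatible w P Q" "w \<ge> 1"
  obtains T where "speed_traversal w (length P) (length Q) T"
    "\<forall>(i, j) \<in> set T. norm (P ! i - Q ! j) \<le> speed_frechet w P Q"
proof -
  let ?cost = "\<lambda>T. Max ((\<lambda>(i, j). norm (P ! i - Q ! j)) ` set T)"
  let ?S = "{T. speed_traversal w (length P) (length Q) T}"
  have "finite ?S"
    by (rule finite_subset[OF _ finite_traversals]) (auto simp: speed_traversal_def)
  moreover have "?S \<noteq> {}" using speed_traversal_exists[OF assms] by auto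
  ultimately have "Min (?cost ` ?S) \<in> ?cost ` ?S" by (intro Min_in) auto
  then obtain T where T: "speed_traversal w (length P) (length Q) T" "speed_frechet w P Q = ?cost T"
    unfolding speed_frechet_def by auto
  have "norm (P ! i - Q ! j) \<le> speed_frechet w P Q" if "(i, j) \<in> set T" for i j
    unfolding T(2) by (rule Max_ge) (use that in \<open>auto intro!: rev_image_eqI\<close>)
  then show thesis using that T(1) by blast
qed

section \<open>Star decompositions and pieces\<close>

text \<open>The centre is existential because it may be the single vertex on either side; later only
  the ball of radius \<open>D\<close> and the length bound matter.\<close>

definition star :: "nat \<Rightarrow> real \<Rightarrow> 'a::real_normed_vector list \<times> 'a list \<Rightarrow> bool" where
  "star w D = (\<lambda>(A, B). A \<noteq> [] \<and> B \<noteq> [] \<and> length A \<le> w \<and> length B \<le> w \<and>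
     (\<exists>c. \<forall>x \<in> set A \<union> set B. norm (x - c) \<le> D))"

text \<open>The traversal is scanned while both index prefixes are kept partitioned into blocks
  whose full product lies in \<open>T\<close>. Each step changes at most the last block and adds at
  most one; pairs of \<open>T\<close> may be left uncovered.\<close>

lemma traversal_index_stars:
  assumes "T \<noteq> []" "hd T = (0, 0)" "successively monotone_step T"
  shows "\<exists>bs. concat (map fst bs) = [0..<Suc (fst (last T))] \<and>
    concat (map snd bs) = [0..<Suc (snd (last T))] \<and>
    (\<forall>(A, B) \<in> set bs. A \<noteq> [] \<and> B \<noteq> [] \<and> (length A = 1 \<or> length B = 1) \<and> set A \<times> set B \<subseteq> set T)"
  using assms
proof (induction T rule: rev_induct)
  case (snoc x T)
  let ?ok = "\<lambda>T (A, B). A \<noteq> [] \<and> B \<noteq> [] \<and> (length A = 1 \<or> length B = 1) \<and> set A \<times> set B \<subseteq> set T"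
  show ?case
  proof (cases "T = []")
    case True
    then show ?thesis using snoc.prems by (intro exI[of _ "[([0], [0])]"]) auto
  next
    case False
    obtain i j where ij: "last T = (i, j)" by fastforce
    have "\<exists>bs. concat (map fst bs) = [0..<Suc i] \<and> concat (map snd bs) = [0..<Suc j] \<and>
        (\<forall>b \<in> set bs. ?ok T b)"
      using snoc.IH snoc.prems False ij by (simp add: successively_append_iff)
    then obtain bs where bs: "concat (map fst bs) = [0..<Suc i]" "concat (map snd bs) = [0..<Suc j]"
        "\<forall>b \<in> set bs. ?ok T b"
      by blast
    then have "bs \<noteq> []" by auto
    then obtain bs' A B where bs': "bs = bs' @ [(A, B)]"
      by (metis append_butlast_last_id surj_pair)
    have AB: "A \<noteq> []" "B \<noteq> []" "length A = 1 \<or> length B = 1" "set A \<times> set B \<subseteq> set T"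
      and ok': "\<forall>b \<in> set bs'. ?ok T b"
      using bs(3) bs' by auto
    have PA: "concat (map fst bs') @ A = [0..<Suc i]" and PB: "concat (map snd bs') @ B = [0..<Suc j]"
      using bs bs' by auto
    have lastA: "last A = i" and lastB: "last B = j"
      using arg_cong[OF PA, of last] arg_cong[OF PB, of last] AB by auto
    have mono: "?ok (T @ [x]) b" if "?ok T b" for b using that by auto
    have ok: "\<forall>b \<in> set bs. ?ok (T @ [x]) b"
      by (rule ballI, rule mono, rule bspec[OF bs(3)])
    have ok'': "\<forall>b \<in> set bs'. ?ok (T @ [x]) b"
      by (rule ballI, rule mono, rule bspec[OF ok'])
    have step: "monotone_step (i, j) x"
      using snoc.prems(3) False ij by (simp add: successively_append_iff)
    then consider "x = (Suc i, Suc j)" | "x = (i, Suc j)" | "x = (Suc i, j)"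
      by (cases x) (auto simp: monotone_step_def)
    then show ?thesis
    proof cases
      case 1
      show ?thesis
        by (rule exI[of _ "bs @ [([Suc i], [Suc j])]"]) (use bs(1,2) ok 1 in auto)
    next
      case 2
      show ?thesis
      proof (cases "length A = 1")
        case True
        then have "A = [i]" using lastA by (cases A) auto
        moreover have "concat (map snd bs') @ B @ [Suc j] = [0..<Suc j] @ [Suc j]"
          using PB by (metis append.assoc)
        ultimately show ?thesis
          using PA AB ok'' 2
          by (intro exI[of _ "bs' @ [([i], B @ [Suc j])]"]) auto
      next
        case False
        then have "B = [j]" using lastB AB by (cases B) auto
        \<comment> \<open>\<open>B\<close> is the single vertex of this block, so
          \<open>Suc j\<close> cannot join it. The last vertex \<open>i\<close> is cut off and opens
          a new block with \<open>Suc j\<close>, which drops the pair \<open>(i, j)\<close>;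
          \<open>A'\<close> is nonempty as \<open>A\<close> has more than one vertex.\<close>
        define A' where "A' = butlast A"
        have A': "A = A' @ [i]" "A' \<noteq> []"
          using False AB(1) lastA unfolding A'_def
          by (metis append_butlast_last_id) (metis False AB(1) append_butlast_last_id append_Nil length_Cons list.size(3) One_nat_def)
        have "concat (map fst (bs' @ [(A', [j]), ([i], [Suc j])])) = [0..<Suc i]"
          using PA A' by simp
        moreover have "concat (map snd (bs' @ [(A', [j]), ([i], [Suc j])])) = [0..<Suc (Suc j)]"
          using PB \<open>B = [j]\<close> by simp
        ultimately show ?thesis
          using 2 A' AB ok'' \<open>B = [j]\<close>
          by (intro exI[of _ "bs' @ [(A', [j]), ([i], [Suc j])]"]) auto
      qed
    next
      case 3
      show ?thesis
      proof (cases "length B = 1")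
        case True
        then have "B = [j]" using lastB by (cases B) auto
        moreover have "concat (map fst bs') @ A @ [Suc i] = [0..<Suc i] @ [Suc i]"
          using PA by (metis append.assoc)
        ultimately show ?thesis
          using PB AB ok'' 3
          by (intro exI[of _ "bs' @ [(A @ [Suc i], [j])]"]) auto
      next
        case False
        then have "A = [i]" using lastA AB by (cases A) auto
        define B' where "B' = butlast B"
        have B': "B = B' @ [j]" "B' \<noteq> []"
          using False AB(2) lastB unfolding B'_def
          by (metis append_butlast_last_id) (metis False AB(2) append_butlast_last_id append_Nil length_Cons list.size(3) One_nat_def)
        have "concat (map snd (bs' @ [([i], B'), ([Suc i], [j])])) = [0..<Suc j]"
          using PB B' by simp
        moreover have "concat (map fst (bs' @ [([i], B'), ([Suc i], [j])])) = [0..<Suc (Suc i)]"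
          using PA \<open>A = [i]\<close> by simp
        ultimately show ?thesis
          using 3 B' AB ok'' \<open>A = [i]\<close>
          by (intro exI[of _ "bs' @ [([i], B'), ([Suc i], [j])]"]) auto
      qed
    qed
  qed
qed simp

text \<open>Since the product of the two sides lies in \<open>T\<close>, one whole side consists of
  partners of any single vertex on the other side, so the speed bound limits its length.\<close>

lemma speed_traversal_stars:
  fixes P Q :: "'a::real_normed_vector list"
  assumes T: "speed_traversal w (length P) (length Q) T" and "P \<noteq> []" "Q \<noteq> []" "0 \<le> D"
    and D: "\<forall>(i, j) \<in> set T. norm (P ! i - Q ! j) \<le> D"
  obtains ss where "concat (map fst ss) = P" "concat (map snd ss) = Q" "\<forall>s \<in> set ss. star w D s"
proof -
  have trav: "T \<noteq> []" "hd T = (0, 0)" "successively monotone_step T"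
      "last T = (length P - 1, length Q - 1)"
    using T by (auto simp: speed_traversal_def traversal_iff)
  have Suc: "Suc (fst (last T)) = length P" "Suc (snd (last T)) = length Q"
    using trav(4) assms(2,3) by auto
  have "\<exists>bs. concat (map fst bs) = [0..<length P] \<and> concat (map snd bs) = [0..<length Q] \<and>
    (\<forall>(A, B) \<in> set bs. A \<noteq> [] \<and> B \<noteq> [] \<and> (length A = 1 \<or> length B = 1) \<and> set A \<times> set B \<subseteq> set T)"
    using traversal_index_stars[OF trav(1-3)] unfolding Suc .
  then obtain bs where bs: "concat (map fst bs) = [0..<length P]" "concat (map snd bs) = [0..<length Q]"
      "\<And>A B. (A, B) \<in> set bs \<Longrightarrow>
        A \<noteq> [] \<and> B \<noteq> [] \<and> (length A = 1 \<or> length B = 1) \<and> set A \<times> set B \<subseteq> set T"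
    by blast
  define ss where "ss = map (\<lambda>(A, B). (map ((!) P) A, map ((!) Q) B)) bs"
  have "concat (map fst ss) = map ((!) P) (concat (map fst bs))"
    "concat (map snd ss) = map ((!) Q) (concat (map snd bs))"
    by (simp_all add: ss_def map_concat o_def case_prod_unfold)
  then have cc: "concat (map fst ss) = P" "concat (map snd ss) = Q"
    unfolding bs by (simp_all add: map_nth)
  have "star w D (map ((!) P) A, map ((!) Q) B)" if AB: "(A, B) \<in> set bs" for A B
  proof -
    note b = bs(3)[OF AB]
    \<comment> \<open>The speed bound counts sets. Blocks cut from repetition-free index lists have
      length equal to cardinality.\<close>
    have "distinct (concat (map fst bs))" "distinct (concat (map snd bs))" unfolding bs by simp_all
    then have dist: "distinct A" "distinct B"
      using AB by (force simp: distinct_concat_iff)+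
    have sub: "set A \<subseteq> {..<length P}" "set B \<subseteq> {..<length Q}"
      using arg_cong[OF bs(1), of set] arg_cong[OF bs(2), of set] AB by fastforce+
    have fin: "finite {j. (i, j) \<in> set T}" "finite {i. (i, j) \<in> set T}" for i j
      by (rule finite_subset[of _ "snd ` set T"], force, simp)
        (rule finite_subset[of _ "fst ` set T"], force, simp)
    have "length B \<le> w"
    proof -
      have "hd A \<in> set A" using b by simp
      then have "set B \<subseteq> {j. (hd A, j) \<in> set T}" "hd A < length P" using b sub by blast+
      then have "card (set B) \<le> w"
        using order_trans[OF card_mono[OF fin(1)]] T unfolding speed_traversal_def by blast
      then show ?thesis using dist by (simp add: distinct_card)
    qed
    moreover have "length A \<le> w"
    proof -
      have "hd B \<in> set B" using b by simp
      then have "set A \<subseteq> {i. (i, hd B) \<in> set T}" "hd B < length Q" using b sub by blast+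
      then have "card (set A) \<le> w"
        using order_trans[OF card_mono[OF fin(2)]] T unfolding speed_traversal_def by blast
      then show ?thesis using dist by (simp add: distinct_card)
    qed
    \<comment> \<open>The single vertex is the centre; \<open>0 \<le> D\<close> covers its distance
      to itself.\<close>
    moreover have "\<exists>c. \<forall>x \<in> set (map ((!) P) A) \<union> set (map ((!) Q) B). norm (x - c) \<le> D"
    proof (cases "length A = 1")
      case True
      then obtain i where "A = [i]" by (cases A) auto
      then show ?thesis using b D \<open>0 \<le> D\<close>
        by (intro exI[of _ "P ! i"]) (auto simp: norm_minus_commute)
    next
      case False
      then obtain j where "B = [j]" using b by (cases B) auto
      then show ?thesis using b D \<open>0 \<le> D\<close>
        by (intro exI[of _ "Q ! j"]) auto
    qed
    ultimately show ?thesis using b by (simp add: star_def)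
  qed
  then have "\<forall>s \<in> set ss. star w D s" by (auto simp: ss_def)
  then show thesis using that cc by blast
qed

section \<open>Chunks of stars and pieces of curves\<close>

lemma length_le_length_concat:
  assumes "\<forall>x \<in> set xs. x \<noteq> []"
  shows "length xs \<le> length (concat xs)"
  using assms
proof (induction xs)
  case (Cons x xs)
  then show ?case by (cases x) auto
qed simp

lemma length_concat_le:
  assumes "\<forall>x \<in> set xs. length x \<le> w"
  shows "length (concat xs) \<le> w * length xs"
  using assms by (induction xs) auto

text \<open>Blocks of \<open>l\<close> entries are cut off in turn. The last chunk takes the
  remainder, just as the last piece of a curve is truncated.\<close>

lemma chunks_exist:
  assumes "l \<ge> 1" "xs \<noteq> []"
  shows "\<exists>cs. concat cs = xs \<and> cs \<noteq> [] \<and> (\<forall>c \<in> set cs. c \<noteq> [] \<and> length c \<le> l) \<and>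
    (\<forall>k < length cs - 1. length (cs ! k) = l)"
  using assms(2)
proof (induction "length xs" arbitrary: xs rule: less_induct)
  case less
  show ?case
  proof (cases "length xs \<le> l")
    case True
    then show ?thesis using less.prems by (intro exI[of _ "[xs]"]) auto
  next
    case False
    then have "length (drop l xs) < length xs" "drop l xs \<noteq> []" using assms(1) by auto
    from less.hyps[OF this] obtain cs where cs: "concat cs = drop l xs" "cs \<noteq> []"
        "\<forall>c \<in> set cs. c \<noteq> [] \<and> length c \<le> l" "\<forall>k < length cs - 1. length (cs ! k) = l"
      by blast
    have "length ((take l xs # cs) ! k) = l" if "k < length cs" for k
      using that cs(4) False by (cases k) auto
    then show ?thesis
      using cs False assms(1) less.prems by (intro exI[of _ "take l xs # cs"]) auto
  qed
qed

lemma breakpoint_Suc: "breakpoint \<rho> m i \<le> breakpoint \<rho> m (Suc i)"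
  by (auto simp: breakpoint_def)

lemma piece_conv_take_drop:
  "piece \<rho> P i =
     take (breakpoint \<rho> (length P) (Suc i) - breakpoint \<rho> (length P) i)
       (drop (breakpoint \<rho> (length P) i) P)"
proof -
  have *: "nths P {a..<b} = take (b - a) (drop a P)" if "a \<le> b" for a b
  proof -
    have "(+) a ` {..<b - a} = {a..<b}" using that by (simp add: lessThan_atLeast0)
    then show ?thesis using nths_drop[of a P "{..<b - a}"] by simp
  qed
  show ?thesis
    unfolding piece_def Suc_eq_plus1[symmetric] by (rule *) (rule breakpoint_Suc)
qed

lemma concat_pieces_upto:
  "concat (map (piece \<rho> P) [0..<k]) = take (breakpoint \<rho> (length P) k) P"
proof (induction k)
  case (Suc k)
  show ?case
    using Suc breakpoint_Suc[of \<rho> "length P" k] take_add[symmetric]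
    by (simp add: piece_conv_take_drop take_add[symmetric])
qed (simp add: breakpoint_def)

text \<open>Provides the witness for the \<open>LEAST\<close> in \<open>num_pieces\<close>:
  \<open>m\<close> positive lengths already add up to at least \<open>m\<close>.\<close>

lemma breakpoint_reaches_end:
  assumes "\<And>i. \<rho> i \<ge> 1"
  shows "breakpoint \<rho> m m = m"
proof -
  have "m \<le> sum \<rho> {..<m}" using sum_mono[of "{..<m}" "\<lambda>_. 1" \<rho>] assms by simp
  then show ?thesis by (simp add: breakpoint_def)
qed

lemma breakpoint_num_pieces:
  assumes "\<And>i. \<rho> i \<ge> 1"
  shows "breakpoint \<rho> m (num_pieces \<rho> m) = m"
  unfolding num_pieces_def by (rule LeastI[of _ m]) (rule breakpoint_reaches_end[OF assms])

lemma concat_pieces: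
  assumes "\<And>i. \<rho> i \<ge> 1"
  shows "concat (map (piece \<rho> P) [0..<num_pieces \<rho> (length P)]) = P"
  using breakpoint_num_pieces[of \<rho> "length P", OF assms] by (simp add: concat_pieces_upto)

text \<open>By minimality of \<open>num_pieces\<close>, earlier breakpoints lie strictly before the
  end, and the next length is positive.\<close>

lemma piece_nonempty:
  assumes "\<And>i. \<rho> i \<ge> 1" "i < num_pieces \<rho> (length P)"
  shows "piece \<rho> P i \<noteq> []"
proof -
  have "breakpoint \<rho> (length P) i \<noteq> length P"
    using not_less_Least assms(2) unfolding num_pieces_def by blast
  then have "breakpoint \<rho> (length P) i < length P" "sum \<rho> {..<i} < length P"
    by (auto simp: breakpoint_def min_def split: if_splits)
  moreover from this assms(1)[of i] have
    "breakpoint \<rho> (length P) i < breakpoint \<rho> (length P) (Suc i)"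
    by (auto simp: breakpoint_def)
  ultimately show ?thesis by (simp add: piece_conv_take_drop)
qed

lemma length_piece_le: "length (piece \<rho> P i) \<le> \<rho> i"
  by (auto simp: piece_conv_take_drop breakpoint_def)

text \<open>Tells which random lengths produce a prescribed partition: all but the last must be hit
  exactly, while any sufficiently large last length works because the piece is cut at the end of the
  curve.\<close>

lemma pieces_eq:
  assumes "Ps \<noteq> []" "\<forall>p \<in> set Ps. p \<noteq> []"
    and "\<And>k. k < length Ps - 1 \<Longrightarrow> \<rho> k = length (Ps ! k)"
    and "length (last Ps) \<le> \<rho> (length Ps - 1)"
  shows "num_pieces \<rho> (length (concat Ps)) = length Ps"
    and "k < length Ps \<Longrightarrow> piece \<rho> (concat Ps) k = Ps ! k"
proof -
  let ?m = "length (concat Ps)"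
  \<comment> \<open>Restricted to \<open>k < length Ps\<close>, because with the last length
    included the sum may overshoot; there the \<open>min\<close> in \<open>breakpoint\<close> takes
    over.\<close>
  have sum: "sum \<rho> {..<k} = length (concat (take k Ps))" if "k < length Ps" for k
    using that
  proof (induction k)
    case (Suc k)
    then show ?case using assms(3)[of k] by (simp add: take_Suc_conv_app_nth)
  qed simp
  have le: "length (concat (take k Ps)) + length (concat (drop k Ps)) = ?m" for k
    by (metis append_take_drop_id concat_append length_append)
  have bp: "breakpoint \<rho> ?m k = length (concat (take k Ps))" if "k \<le> length Ps" for k
  proof (cases "k = length Ps")
    case True
    then obtain k' where k: "k = Suc k'" "k' < length Ps" by (cases k) (use assms(1) True in auto)
    have "?m = length (concat (take k' Ps)) + length (last Ps)"
      using k True by (metis append_butlast_last_id assms(1) butlast_conv_take concat.simps concat_append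
          append_Nil2 diff_Suc_1 length_append)
    also have "\<dots> \<le> sum \<rho> {..<k}"
      using sum[OF k(2)] assms(4) k True by simp
    finally show ?thesis using True by (simp add: breakpoint_def)
  next
    case False
    then show ?thesis using sum[of k] that le[of k] by (simp add: breakpoint_def)
  qed
  have less: "breakpoint \<rho> ?m k \<noteq> ?m" if "k < length Ps" for k
  proof -
    have "drop k Ps \<noteq> []" using that by simp
    moreover have "\<forall>p \<in> set (drop k Ps). p \<noteq> []" using assms(2) by (meson in_set_dropD)
    ultimately have "length (concat (drop k Ps)) > 0"
      using length_le_length_concat[of "drop k Ps"] by (metis gr0I length_0_conv le_zero_eq)
    then show ?thesis using bp[OF less_imp_le[OF that]] le[of k] by linarith
  qed
  have "breakpoint \<rho> ?m (length Ps) = ?m" using bp[of "length Ps"] by simp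
  then show "num_pieces \<rho> ?m = length Ps"
    unfolding num_pieces_def by (rule Least_equality) (use less in \<open>metis not_le\<close>)
  show "piece \<rho> (concat Ps) k = Ps ! k" if "k < length Ps"
  proof -
    have dec: "Ps = take k Ps @ Ps ! k # drop (Suc k) Ps" using that by (simp add: id_take_nth_drop)
    have b: "breakpoint \<rho> ?m (Suc k) = breakpoint \<rho> ?m k + length (Ps ! k)"
      using bp[of k] bp[of "Suc k"] that by (simp add: take_Suc_conv_app_nth)
    have "concat Ps = concat (take k Ps) @ Ps ! k @ concat (drop (Suc k) Ps)"
      by (subst dec) simp
    then have "drop (breakpoint \<rho> ?m k) (concat Ps) = Ps ! k @ concat (drop (Suc k) Ps)"
      using bp[of k] that by simp
    then show ?thesis unfolding piece_conv_take_drop b by simp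
  qed
qed

lemma remdups_adj_constant_block:
  assumes "A \<noteq> []" "\<forall>x \<in> set A. f x = v"
  shows "remdups_adj (map f A @ ys) = remdups_adj (v # ys)"
  using assms
proof (induction A)
  case (Cons x A)
  then show ?case by (cases "A = []") (auto simp: remdups_adj_Cons split: list.split)
qed simp

text \<open>Corresponding blocks collapse to the same single value, and neighbouring blocks with
  equal values merge on both sides alike.\<close>

lemma remdups_adj_concat_blocks:
  assumes "\<forall>(A, B) \<in> set ss. A \<noteq> [] \<and> B \<noteq> [] \<and> (\<exists>v. \<forall>x \<in> set A \<union> set B. f x = v)"
  shows "remdups_adj (map f (concat (map fst ss))) = remdups_adj (map f (concat (map snd ss)))"
  using assms
proof (induction ss)
  case (Cons s ss)
  obtain A B where s: "s = (A, B)" by fastforce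
  with Cons.prems obtain v where "A \<noteq> []" "B \<noteq> []" "\<forall>x \<in> set A. f x = v" "\<forall>x \<in> set B. f x = v"
    by auto
  then show ?case
    using Cons s by (simp add: remdups_adj_constant_block[of _ f v]) (simp add: remdups_adj_Cons)
qed simp

section \<open>Grid cells\<close>

text \<open>Coordinatewise rounding with halves rounded down, since the lexicographic tie rule
  prefers the smaller coordinate.\<close>

definition grid_cell :: "real \<Rightarrow> real ^ 'n \<Rightarrow> real ^ 'n \<Rightarrow> int ^ 'n" where
  "grid_cell \<delta> t p = (\<chi> i. \<lceil>(p $ i - t $ i) / \<delta> - 1 / 2\<rceil>)"

definition cell_point :: "real \<Rightarrow> real ^ 'n \<Rightarrow> int ^ 'n \<Rightarrow> real ^ 'n" where
  "cell_point \<delta> t z = (\<chi> i. t $ i + \<delta> * of_int (z $ i))"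

text \<open>The rounded integer \<open>z\<close> satisfies \<open>z - 1 / 2 < u\<close> and
  \<open>u \<le> z + 1 / 2\<close>. The strict inequality makes all smaller integers strictly
  farther, so ties occur only with larger ones.\<close>

lemma nearest_int:
  fixes u :: real and k :: int
  shows "\<bar>u - of_int \<lceil>u - 1 / 2\<rceil>\<bar> \<le> \<bar>u - of_int k\<bar>"
    and "\<bar>u - of_int \<lceil>u - 1 / 2\<rceil>\<bar> = \<bar>u - of_int k\<bar> \<Longrightarrow> \<lceil>u - 1 / 2\<rceil> \<le> k"
proof -
  define z where "z = \<lceil>u - 1 / 2\<rceil>"
  have z: "of_int z - 1 < u - 1 / 2" "u - 1 / 2 \<le> of_int z"
    unfolding z_def by linarith+
  have "\<bar>u - of_int z\<bar> \<le> \<bar>u - of_int k\<bar> \<and> (\<bar>u - of_int z\<bar> = \<bar>u - of_int k\<bar> \<longrightarrow> z \<le> k)"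
  proof (cases "z \<le> k")
    case True
    then have "k = z \<or> real_of_int k \<ge> of_int z + 1" by linarith
    then show ?thesis using z True by auto
  next
    case False
    then have "real_of_int k \<le> of_int z - 1" by linarith
    then show ?thesis using z by linarith
  qed
  then show "\<bar>u - of_int \<lceil>u - 1 / 2\<rceil>\<bar> \<le> \<bar>u - of_int k\<bar>"
    "\<bar>u - of_int \<lceil>u - 1 / 2\<rceil>\<bar> = \<bar>u - of_int k\<bar> \<Longrightarrow> \<lceil>u - 1 / 2\<rceil> \<le> k"
    by (simp_all add: z_def)
qed

lemma shifted_grid_iff: "x \<in> shifted_grid \<delta> t \<longleftrightarrow> (\<exists>z. x = cell_point \<delta> t z)"
proof
  assume "x \<in> shifted_grid \<delta> t"
  then obtain p where p: "x = p + t" "\<forall>i. \<exists>z::int. p $ i = \<delta> * of_int z"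
    by (auto simp: shifted_grid_def)
  from p(2) obtain f :: "'a \<Rightarrow> int" where "\<forall>i. p $ i = \<delta> * of_int (f i)" by metis
  then have "x = cell_point \<delta> t (\<chi> i. f i)"
    using p(1) by (simp add: cell_point_def vec_eq_iff)
  then show "\<exists>z. x = cell_point \<delta> t z" ..
next
  assume "\<exists>z. x = cell_point \<delta> t z"
  then obtain z where "x = cell_point \<delta> t z" ..
  then have "x = (\<chi> i. \<delta> * of_int (z $ i)) + t"
    by (simp add: cell_point_def vec_eq_iff)
  then show "x \<in> shifted_grid \<delta> t"
    unfolding shifted_grid_def by fastforce
qed

lemma cell_point_diff:
  assumes "\<delta> > 0"
  shows "\<bar>p $ i - cell_point \<delta> t z $ i\<bar> = \<delta> * \<bar>(p $ i - t $ i) / \<delta> - of_int (z $ i)\<bar>"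
proof -
  have "p $ i - cell_point \<delta> t z $ i = \<delta> * ((p $ i - t $ i) / \<delta> - of_int (z $ i))"
    using assms by (simp add: cell_point_def field_simps)
  then show ?thesis using assms by (simp add: abs_mult)
qed

text \<open>The grid is a product, so rounding every coordinate minimises all coordinate distances
  at once. A rival closest point must tie in every coordinate, hence is nowhere smaller, and this
  gives lexicographic minimality and uniqueness.\<close>

lemma snap_eq_cell_point:
  fixes t p :: "real ^ 'n::{finite, linorder}"
  assumes "\<delta> > 0"
  shows "snap \<delta> t p = cell_point \<delta> t (grid_cell \<delta> t p)"
proof -
  let ?x = "cell_point \<delta> t (grid_cell \<delta> t p)"
  have le: "\<bar>p $ i - ?x $ i\<bar> \<le> \<bar>p $ i - y $ i\<bar>" if "y \<in> shifted_grid \<delta> t" for y i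
    using that nearest_int(1)[of "(p $ i - t $ i) / \<delta>"] assms
    by (auto simp: shifted_grid_iff cell_point_diff grid_cell_def)
  have closest: "?x \<in> closest_grid_points \<delta> t p"
    unfolding closest_grid_points_def
  proof (intro CollectI conjI ballI norm_le_componentwise_cart)
    show "?x \<in> shifted_grid \<delta> t" by (auto simp: shifted_grid_iff)
    show "norm ((p - ?x) $ i) \<le> norm ((p - y) $ i)" if "y \<in> shifted_grid \<delta> t" for y i
      using le[OF that] by simp
  qed
  have below: "?x $ i \<le> y $ i" if y: "y \<in> closest_grid_points \<delta> t p" for y i
  proof -
    have yg: "y \<in> shifted_grid \<delta> t" and "norm (p - y) \<le> norm (p - ?x)"
      using y closest by (auto simp: closest_grid_points_def)
    then have "(\<Sum>i\<in>UNIV. (p $ i - y $ i)\<^sup>2) \<le> (\<Sum>i\<in>UNIV. (p $ i - ?x $ i)\<^sup>2)"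
      by (simp add: norm_vec_def L2_set_def)
    moreover have "(p $ i - ?x $ i)\<^sup>2 \<le> (p $ i - y $ i)\<^sup>2" for i
      using le[OF yg] by (simp add: abs_le_square_iff)
    \<comment> \<open>The sums are ordered one way and the terms the other way, which forces
      equality of all terms.\<close>
    ultimately have "(p $ i - ?x $ i)\<^sup>2 = (p $ i - y $ i)\<^sup>2"
      by (intro sum_mono_inv[of "\<lambda>i. (p $ i - ?x $ i)\<^sup>2" UNIV "\<lambda>i. (p $ i - y $ i)\<^sup>2"])
        (auto intro!: antisym sum_mono)
    then have "\<bar>p $ i - ?x $ i\<bar> = \<bar>p $ i - y $ i\<bar>"
      by (simp add: eq_iff abs_le_square_iff)
    moreover obtain z where z: "y = cell_point \<delta> t z" using yg shifted_grid_iff by blast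
    ultimately have "grid_cell \<delta> t p $ i \<le> z $ i"
      using assms nearest_int(2)[of "(p $ i - t $ i) / \<delta>" "z $ i"]
      by (simp add: cell_point_diff grid_cell_def)
    then show ?thesis using assms by (simp add: z cell_point_def)
  qed
  have least: "lex_le ?x y" if y: "y \<in> closest_grid_points \<delta> t p" for y
  proof (cases "?x = y")
    case False
    \<comment> \<open>The first differing coordinate decides the lexicographic comparison.\<close>
    let ?K = "{i. ?x $ i \<noteq> y $ i}"
    have K: "finite ?K" "?K \<noteq> {}" using False by (auto simp: vec_eq_iff)
    have "Min ?K \<in> ?K" by (rule Min_in[OF K])
    then have "?x $ Min ?K < y $ Min ?K" using below[OF y] by (simp add: less_le)
    moreover have "?x $ i = y $ i" if "i < Min ?K" for i
    proof (rule ccontr)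
      assume "?x $ i \<noteq> y $ i"
      then have "Min ?K \<le> i" using K(1) by (intro Min_le) auto
      with that show False by simp
    qed
    ultimately show ?thesis unfolding lex_le_def by blast
  qed (simp add: lex_le_def)
  show ?thesis
    unfolding snap_def
  proof (rule the_equality)
    fix y assume y: "y \<in> closest_grid_points \<delta> t p \<and> (\<forall>x \<in> closest_grid_points \<delta> t p. lex_le y x)"
    then have "lex_le y ?x" using closest by blast
    show "y = ?x"
    proof (rule ccontr)
      assume "y \<noteq> ?x"
      then obtain k where "y $ k < ?x $ k" using \<open>lex_le y ?x\<close> unfolding lex_le_def by blast
      then show False using below[of y k] y by simp
    qed
  qed (use closest least in blast)
qed

lemma inj_cell_point:
  assumes "\<delta> > 0"
  shows "inj (cell_point \<delta> t)"
  using assms by (auto simp: inj_def cell_point_def vec_eq_iff)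

text \<open>Duplicate removal commutes with the injective map from cells to grid points. Integer
  cells take only countably many values, which the measurability proofs exploit.\<close>

lemma basic_hash_eq_iff:
  fixes t :: "real ^ 'n::{finite, linorder}"
  assumes "\<delta> > 0"
  shows "basic_hash \<delta> t A = basic_hash \<delta> t B \<longleftrightarrow>
    remdups_adj (map (grid_cell \<delta> t) A) = remdups_adj (map (grid_cell \<delta> t) B)"
proof -
  have "basic_hash \<delta> t C = map (cell_point \<delta> t) (remdups_adj (map (grid_cell \<delta> t) C))" for C
    unfolding basic_hash_def remdups_adj_map_injective[OF inj_cell_point[OF assms], symmetric]
    by (simp add: ext[of "snap \<delta> t", OF snap_eq_cell_point[OF assms]] o_def)
  then show ?thesis by (simp add: inj_map_eq_map[OF inj_cell_point[OF assms]])
qed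

lemma speed_hash_eq_iff:
  assumes "\<delta> > 0"
  shows "speed_hash \<delta> t \<rho> P = speed_hash \<delta> t \<sigma> Q \<longleftrightarrow>
    num_pieces \<rho> (length P) = num_pieces \<sigma> (length Q) \<and>
    (\<forall>i < num_pieces \<rho> (length P).
       remdups_adj (map (grid_cell \<delta> (t i)) (piece \<rho> P i)) =
       remdups_adj (map (grid_cell \<delta> (t i)) (piece \<sigma> Q i)))"
  unfolding speed_hash_def basic_hash_eq_iff[OF assms, symmetric]
  by (auto simp: list_eq_iff_nth_eq)

text \<open>Reals with equal ceilings differ by at most 1, which after scaling bounds each
  coordinate by \<open>\<delta>\<close>.\<close>

lemma norm_le_of_same_cell:
  fixes t p q :: "real ^ 'n"
  assumes "\<delta> > 0" "grid_cell \<delta> t p = grid_cell \<delta> t q"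
  shows "norm (p - q) \<le> sqrt (real CARD('n)) * \<delta>"
proof -
  have "\<bar>(p - q) $ i\<bar> \<le> \<delta>" for i
  proof -
    have "\<lceil>(p $ i - t $ i) / \<delta> - 1 / 2\<rceil> = \<lceil>(q $ i - t $ i) / \<delta> - 1 / 2\<rceil>"
      using assms(2) by (simp add: grid_cell_def vec_eq_iff)
    then have "\<bar>(p $ i - t $ i) / \<delta> - (q $ i - t $ i) / \<delta>\<bar> \<le> 1" by linarith
    also have "(p $ i - t $ i) / \<delta> - (q $ i - t $ i) / \<delta> = (p - q) $ i / \<delta>"
      by (simp add: diff_divide_distrib)
    finally show ?thesis using assms(1) by (simp add: abs_divide)
  qed
  then have "norm (p - q) \<le> norm (\<chi> i::'n. \<delta>)"
    using assms(1) by (intro norm_le_componentwise_cart) simp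
  also have "\<dots> = sqrt (real CARD('n)) * \<delta>"
    using assms(1) by (simp add: norm_vec_def L2_set_def real_sqrt_mult)
  finally show ?thesis .
qed

text \<open>The deterministic core of (ii). Equal hashes couple the pieces with equal index run by
  run; the bound \<open>N\<close> on the piece lengths becomes the speed, and the cell diameter
  becomes the cost.\<close>

lemma speed_frechet_le_of_hash_eq:
  fixes P Q :: "(real ^ 'n::{finite, linorder}) list"
  assumes "\<delta> > 0" "P \<noteq> []" "Q \<noteq> []"
    and \<rho>: "\<And>i. \<rho> i \<in> {1..N}" and \<sigma>: "\<And>i. \<sigma> i \<in> {1..N}"
    and hash: "speed_hash \<delta> t \<rho> P = speed_hash \<delta> t \<sigma> Q"
  shows "speed_frechet N P Q \<le> sqrt (real CARD('n)) * \<delta>"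
proof -
  define K where "K = num_pieces \<rho> (length P)"
  have K': "num_pieces \<sigma> (length Q) = K"
    using hash by (simp add: speed_hash_eq_iff[OF assms(1)] K_def)
  have P: "concat (map (piece \<rho> P) [0..<K]) = P" and Q: "concat (map (piece \<sigma> Q) [0..<K]) = Q"
    using concat_pieces[of \<rho> P] concat_pieces[of \<sigma> Q] \<rho> \<sigma> K' by (simp_all add: K_def)
  have "K > 0" using P assms(2) by (cases K) auto
  have "coupled N (\<lambda>x y. norm (x - y) \<le> sqrt (real CARD('n)) * \<delta>)
      (concat (map (piece \<rho> P) [0..<K])) (concat (map (piece \<sigma> Q) [0..<K]))"
  proof (rule coupled_concat)
    fix k assume "k < length (map (piece \<rho> P) [0..<K])"
    then have k: "k < K" by simp
    have ne: "piece \<rho> P k \<noteq> []" "piece \<sigma> Q k \<noteq> []"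
      using piece_nonempty[of \<rho> k P] piece_nonempty[of \<sigma> k Q] \<rho> \<sigma> k K' by (auto simp: K_def)
    have "coupled N (\<lambda>x y. grid_cell \<delta> (t k) x = grid_cell \<delta> (t k) y) (piece \<rho> P k) (piece \<sigma> Q k)"
    proof (rule coupled_runs)
      show "length (piece \<rho> P k) \<le> N" "length (piece \<sigma> Q k) \<le> N"
        using length_piece_le[of \<rho> P k] length_piece_le[of \<sigma> Q k] \<rho>[of k] \<sigma>[of k] by auto
    qed (use hash k ne in \<open>simp_all add: speed_hash_eq_iff[OF assms(1)] K_def\<close>)
    then have "coupled N (\<lambda>x y. norm (x - y) \<le> sqrt (real CARD('n)) * \<delta>) (piece \<rho> P k) (piece \<sigma> Q k)"
      by (rule coupled_mono) (use ne norm_le_of_same_cell[OF assms(1)] in blast)+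
    then show "map (piece \<rho> P) [0..<K] ! k \<noteq> [] \<and> map (piece \<sigma> Q) [0..<K] ! k \<noteq> [] \<and>
        coupled N (\<lambda>x y. norm (x - y) \<le> sqrt (real CARD('n)) * \<delta>)
          (map (piece \<rho> P) [0..<K] ! k) (map (piece \<sigma> Q) [0..<K] ! k)"
      using ne k by simp
  qed (use \<open>K > 0\<close> in auto)
  then show ?thesis unfolding P Q by (rule speed_frechet_le)
qed

section \<open>Random shifts and lengths\<close>

text \<open>Rounding is monotone, so comparing the two endpoints controls the whole interval from
  \<open>x - D\<close> to \<open>x + D\<close>.\<close>

definition straddle :: "real \<Rightarrow> real \<Rightarrow> real \<Rightarrow> real set" where
  "straddle \<delta> D x = {s. \<lceil>(x - D - s) / \<delta> - 1 / 2\<rceil> \<noteq> \<lceil>(x + D - s) / \<delta> - 1 / 2\<rceil>}"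

text \<open>Modulo \<open>\<delta>\<close>, the shifts that separate \<open>x - D\<close> from \<open>x + D\<close> form an arc of length \<open>2 D\<close>,
  which may wrap around the end of the period; hence two intervals.\<close>

lemma straddle_cover:
  assumes "\<delta> > 0" "0 \<le> D" "2 * D \<le> \<delta>"
  obtains a where "0 \<le> a" "a \<le> \<delta>"
    "straddle \<delta> D x \<inter> {0..<\<delta>} \<subseteq> {a..min (a + 2 * D) \<delta>} \<union> {0..max 0 (a + 2 * D - \<delta>)}"
proof -
  \<comment> \<open>Chosen so that the two ceilings become those of
    \<open>(y - s) / \<delta>\<close> and \<open>(y + 2 * D - s) / \<delta>\<close>;
    \<open>a\<close> is the residue of \<open>y\<close> modulo \<open>\<delta>\<close>, where the
    arc starts.\<close>
  define y where "y = x - D - \<delta> / 2"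
  define n where "n = \<lfloor>y / \<delta>\<rfloor>"
  define a where "a = y - \<delta> * of_int n"
  have "of_int n \<le> y / \<delta>" "y / \<delta> < of_int n + 1" unfolding n_def by linarith+
  then have a: "0 \<le> a" "a < \<delta>" using assms(1) by (simp_all add: a_def field_simps)
  have "s \<in> {a..min (a + 2 * D) \<delta>} \<union> {0..max 0 (a + 2 * D - \<delta>)}"
    if s: "s \<in> straddle \<delta> D x" "0 \<le> s" "s < \<delta>" for s
  proof -
    define z where "z = \<lceil>(x - D - s) / \<delta> - 1 / 2\<rceil>"
    have u: "(x - D - s) / \<delta> - 1 / 2 = (y - s) / \<delta>" "(x + D - s) / \<delta> - 1 / 2 = (y + 2 * D - s) / \<delta>"
      using assms(1) by (simp_all add: y_def field_simps)
    have "(y - s) / \<delta> \<le> (y + 2 * D - s) / \<delta>" using assms by (simp add: divide_right_mono)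
    then have "\<lceil>(y - s) / \<delta>\<rceil> \<le> \<lceil>(y + 2 * D - s) / \<delta>\<rceil>" by (rule ceiling_mono)
    moreover have "\<lceil>(y - s) / \<delta>\<rceil> \<noteq> \<lceil>(y + 2 * D - s) / \<delta>\<rceil>"
      using s(1) by (simp only: straddle_def mem_Collect_eq u not_False_eq_True)
    ultimately have "z < \<lceil>(y + 2 * D - s) / \<delta>\<rceil>" unfolding z_def u by simp
    then have "of_int z < (y + 2 * D - s) / \<delta>" by (simp add: less_ceiling_iff)
    moreover have "(y - s) / \<delta> \<le> of_int z" unfolding z_def u by linarith
    ultimately
    have "y - s \<le> \<delta> * of_int z" "\<delta> * of_int z < y + 2 * D - s"
      using assms(1) by (simp_all add: field_simps)
    then have k: "a + \<delta> * of_int (n - z) \<le> s" "s < a + 2 * D + \<delta> * of_int (n - z)"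
      by (simp_all add: a_def algebra_simps)
    have "\<delta> * of_int (n - z) < \<delta> * 1" using k s a by linarith
    then have "n - z < 1" using assms(1) by (simp add: mult_less_cancel_left_pos del: of_int_diff)
    moreover have "\<delta> * of_int (- 2) < \<delta> * of_int (n - z)" using k s a assms by linarith
    then have "- 2 < n - z" using assms(1) by (simp only: mult_less_cancel_left_pos of_int_less_iff)
    \<comment> \<open>The value 0 is the arc from \<open>a\<close> on, the value -1 its part wrapped
      around to the start of the period.\<close>
    ultimately have "n - z = 0 \<or> n - z = - 1" by linarith
    then show ?thesis using k s by (elim disjE) (simp_all only: , auto)
  qed
  then show thesis using that[of a] a by fastforce
qed

section \<open>The uniform law of one shift\<close>

definition shift_cube :: "real \<Rightarrow> (real ^ 'n) set" where
  "shift_cube \<delta> = {x. \<forall>i. 0 \<le> x $ i \<and> x $ i < \<delta>}"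

lemma measure_cbox_vec:
  assumes "\<And>i. a $ i \<le> b $ i"
  shows "measure lborel (cbox a b) = (\<Prod>i\<in>UNIV. b $ i - a $ i)"
    and "emeasure lborel (cbox a b) = ennreal (\<Prod>i\<in>UNIV. b $ i - a $ i)"
proof -
  have "cbox a b \<noteq> {}" using assms by (simp add: interval_ne_empty_cart)
  then show "measure lborel (cbox a b) = (\<Prod>i\<in>UNIV. b $ i - a $ i)"
    by (rule content_cbox_cart)
  then show "emeasure lborel (cbox a b) = ennreal (\<Prod>i\<in>UNIV. b $ i - a $ i)"
    using emeasure_eq_ennreal_measure[of lborel "cbox a b"] emeasure_lborel_cbox_finite[of a b] by simp
qed

lemma shift_cube_borel [measurable]: "shift_cube \<delta> \<in> sets borel"
proof -
  have eq: "shift_cube \<delta> = (\<Inter>i. {x. 0 \<le> x $ i} \<inter> {x. x $ i < \<delta>})"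
    by (auto simp: shift_cube_def)
  show ?thesis
    unfolding eq
    by (intro sets.finite_INT sets.Int borel_closed borel_open closed_Collect_le open_Collect_less
        continuous_intros) auto
qed

lemma box_subset_shift_cube: "box 0 (\<chi> i. \<delta>) \<subseteq> shift_cube \<delta>"
  by (auto simp: shift_cube_def mem_box_cart intro: less_imp_le)

text \<open>The half-open cube lies between the open and the closed box, which have the same
  volume.\<close>

lemma emeasure_shift_cube:
  assumes "\<delta> > 0"
  shows "emeasure lborel (shift_cube \<delta> :: (real ^ 'n) set) = ennreal (\<delta> ^ CARD('n))"
proof (rule antisym)
  let ?u = "(\<chi> i. \<delta>) :: real ^ 'n"
  have c: "emeasure lborel (cbox 0 ?u) = ennreal (\<delta> ^ CARD('n))"
    using assms by (subst measure_cbox_vec) auto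
  show "emeasure lborel (shift_cube \<delta> :: (real ^ 'n) set) \<le> ennreal (\<delta> ^ CARD('n))"
    unfolding c[symmetric]
    by (rule emeasure_mono) (auto simp: shift_cube_def mem_box_cart less_imp_le)
  have b: "emeasure lborel (box 0 ?u) = ennreal (\<delta> ^ CARD('n))"
    unfolding c[symmetric] emeasure_lborel_box_eq emeasure_lborel_cbox_eq ..
  have "emeasure lborel (box 0 ?u) \<le> emeasure lborel (shift_cube \<delta> :: (real ^ 'n) set)"
    by (intro emeasure_mono box_subset_shift_cube) simp
  then show "ennreal (\<delta> ^ CARD('n)) \<le> emeasure lborel (shift_cube \<delta> :: (real ^ 'n) set)"
    unfolding b .
qed

abbreviation shift_law :: "real \<Rightarrow> (real ^ 'n) measure" where
  "shift_law \<delta> \<equiv> uniform_measure lborel (shift_cube \<delta>)"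

lemma prob_space_shift_law:
  assumes "\<delta> > 0"
  shows "prob_space (shift_law \<delta>)"
  by (rule prob_space_uniform_measure) (use assms in \<open>simp_all add: emeasure_shift_cube ennreal_eq_0_iff not_le\<close>)

lemma borel_measurable_component: "(\<lambda>x::real ^ 'n. x $ i) \<in> borel_measurable borel"
  by (intro borel_measurable_continuous_onI continuous_intros)

lemma straddle_borel: "{s::real ^ 'n. s $ i \<in> straddle \<delta> D x} \<in> sets borel"
proof -
  note borel_measurable_component[of i, measurable]
  have "{s \<in> space borel. \<not> \<lceil>(x - D - s $ i) / \<delta> - 1 / 2\<rceil> = \<lceil>(x + D - s $ i) / \<delta> - 1 / 2\<rceil>} \<in> sets borel"
    by measurable
  then show ?thesis by (simp add: straddle_def)
qed

lemma measure_slab: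
  fixes i :: "'n::finite"
  assumes "\<delta> > 0" "u \<le> v"
  shows "measure lborel (cbox (\<chi> j. if j = i then u else 0) (\<chi> j. if j = i then v else \<delta>) :: (real ^ 'n) set)
    = (v - u) * \<delta> ^ (CARD('n) - 1)"
proof -
  have "measure lborel (cbox (\<chi> j. if j = i then u else 0) (\<chi> j. if j = i then v else \<delta>) :: (real ^ 'n) set)
      = (\<Prod>j\<in>UNIV. if j = i then v - u else \<delta>)"
    by (subst measure_cbox_vec) (use assms in \<open>auto intro!: prod.cong\<close>)
  also have "\<dots> = (v - u) * (\<Prod>j\<in>UNIV - {i}. if j = i then v - u else \<delta>)"
    by (subst prod.remove[of UNIV i]) auto
  also have "(\<Prod>j\<in>UNIV - {i}. if j = i then v - u else \<delta>) = (\<Prod>j\<in>UNIV - {i}. \<delta>)"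
    by (rule prod.cong) auto
  finally show ?thesis by (simp add: card_Diff_singleton)
qed

text \<open>The two covering intervals yield two slabs of the cube, whose total volume is compared
  with that of the cube.\<close>

lemma prob_straddle_le:
  fixes i :: "'n::finite"
  assumes "\<delta> > 0" "0 \<le> D" "2 * D \<le> \<delta>"
  shows "measure (shift_law \<delta>) {s::real ^ 'n. s $ i \<in> straddle \<delta> D x} \<le> 2 * D / \<delta>"
proof -
  obtain a where a: "0 \<le> a" "a \<le> \<delta>"
      "straddle \<delta> D x \<inter> {0..<\<delta>} \<subseteq> {a..min (a + 2 * D) \<delta>} \<union> {0..max 0 (a + 2 * D - \<delta>)}"
    using straddle_cover[OF assms] by blast
  define slab where "slab u v = (cbox (\<chi> j. if j = i then u else 0) (\<chi> j. if j = i then v else \<delta>) :: (real ^ 'n) set)" for u v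
  let ?b = "min (a + 2 * D) \<delta>" and ?e = "max 0 (a + 2 * D - \<delta>)"
  have sub: "shift_cube \<delta> \<inter> {s. s $ i \<in> straddle \<delta> D x} \<subseteq> slab a ?b \<union> slab 0 ?e"
  proof
    fix s assume "s \<in> shift_cube \<delta> \<inter> {s. s $ i \<in> straddle \<delta> D x}"
    then have s: "\<And>j. 0 \<le> s $ j" "\<And>j. s $ j < \<delta>" "s $ i \<in> straddle \<delta> D x"
      by (auto simp: shift_cube_def)
    then have "s $ i \<in> {a..?b} \<union> {0..?e}" using a(3) by auto
    moreover have "s \<in> slab u v" if "u \<le> s $ i" "s $ i \<le> v" for u v
      using that s by (auto simp: slab_def mem_box_cart intro: less_imp_le)
    ultimately show "s \<in> slab a ?b \<union> slab 0 ?e" by auto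
  qed
  have "measure lborel (shift_cube \<delta> \<inter> {s. s $ i \<in> straddle \<delta> D x}) \<le> measure lborel (slab a ?b \<union> slab 0 ?e)"
    by (rule measure_mono_fmeasurable[OF sub])
      (auto simp: slab_def straddle_borel intro!: fmeasurable.Un)
  also have "\<dots> \<le> measure lborel (slab a ?b) + measure lborel (slab 0 ?e)"
    by (rule measure_Un_le) (auto simp: slab_def)
  also have "\<dots> = (?b - a) * \<delta> ^ (CARD('n) - 1) + (?e - 0) * \<delta> ^ (CARD('n) - 1)"
    unfolding slab_def using assms a by (subst (1 2) measure_slab) auto
  \<comment> \<open>Whether or not the arc wraps around, the two widths add up to
    \<open>2 * D\<close>.\<close>
  also have "\<dots> = 2 * D * \<delta> ^ (CARD('n) - 1)"
    by (auto simp: min_def max_def algebra_simps)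
  finally have le: "measure lborel (shift_cube \<delta> \<inter> {s. s $ i \<in> straddle \<delta> D x}) \<le> 2 * D * \<delta> ^ (CARD('n) - 1)" .
  have pw: "\<delta> ^ CARD('n) = \<delta> * \<delta> ^ (CARD('n) - 1)"
    by (metis power_eq_if zero_less_card_finite less_not_refl)
  have "measure (shift_law \<delta>) {s. s $ i \<in> straddle \<delta> D x} =
      measure lborel (shift_cube \<delta> \<inter> {s. s $ i \<in> straddle \<delta> D x}) / \<delta> ^ CARD('n)"
    using assms(1) by (subst measure_uniform_measure)
      (simp_all add: emeasure_shift_cube straddle_borel ennreal_eq_0_iff not_le measure_def)
  also have "\<dots> \<le> 2 * D * \<delta> ^ (CARD('n) - 1) / \<delta> ^ CARD('n)"
    using le assms(1) by (intro divide_right_mono) auto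
  also have "\<dots> = 2 * D / \<delta>" using assms(1) by (simp add: pw)
  finally show ?thesis .
qed

text \<open>The good event for the shift of one chunk, with \<open>cs\<close> the centres of its
  stars.\<close>

definition unsplit :: "real \<Rightarrow> real \<Rightarrow> (real ^ 'n) list \<Rightarrow> (real ^ 'n) set" where
  "unsplit \<delta> D cs = {s. \<forall>c \<in> set cs. \<forall>i. s $ i \<notin> straddle \<delta> D (c $ i)}"

lemma unsplit_borel: "unsplit \<delta> D cs \<in> sets borel"
proof -
  have "unsplit \<delta> D cs = UNIV - (\<Union>c \<in> set cs. \<Union>i. {s. s $ i \<in> straddle \<delta> D (c $ i)})"
    by (auto simp: unsplit_def)
  then show ?thesis by (auto intro!: sets.Diff sets.finite_UN straddle_borel simp del: UNIV_I)
qed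

text \<open>Union bound over all centres and coordinates.\<close>

lemma prob_unsplit_ge:
  fixes cs :: "(real ^ 'n) list"
  assumes "\<delta> > 0" "0 \<le> D" "2 * D \<le> \<delta>"
  shows "measure (shift_law \<delta>) (unsplit \<delta> D cs) \<ge> 1 - real (length cs) * real CARD('n) * (2 * D / \<delta>)"
proof -
  interpret prob_space "shift_law \<delta> :: (real ^ 'n) measure" by (rule prob_space_shift_law[OF assms(1)])
  define B where "B c i = {s::real ^ 'n. s $ i \<in> straddle \<delta> D (c $ i)}" for c :: "real ^ 'n" and i
  have B: "B c i \<in> sets (shift_law \<delta>)" for c i by (simp add: B_def straddle_borel)
  have "unsplit \<delta> D cs = space (shift_law \<delta>) - (\<Union>c \<in> set cs. \<Union>i. B c i)"
    by (auto simp: unsplit_def B_def)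
  then have "prob (unsplit \<delta> D cs) = 1 - prob (\<Union>c \<in> set cs. \<Union>i. B c i)"
    using B by (simp add: prob_compl[symmetric] sets.finite_UN)
  moreover have "prob (\<Union>c \<in> set cs. \<Union>i. B c i) \<le> (\<Sum>c \<in> set cs. prob (\<Union>i. B c i))"
    using B by (intro measure_UNION_le) (auto simp del: sets_uniform_measure)
  moreover have "\<dots> \<le> (\<Sum>c \<in> set cs. real CARD('n) * (2 * D / \<delta>))"
  proof (rule sum_mono)
    fix c
    have "prob (\<Union>i. B c i) \<le> (\<Sum>i\<in>UNIV. prob (B c i))"
      using B by (intro measure_UNION_le) auto
    also have "\<dots> \<le> (\<Sum>i\<in>(UNIV :: 'n set). 2 * D / \<delta>)"
      unfolding B_def by (intro sum_mono prob_straddle_le assms)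
    finally show "prob (\<Union>i. B c i) \<le> real CARD('n) * (2 * D / \<delta>)" by simp
  qed
  moreover have "\<dots> \<le> real (length cs) * (real CARD('n) * (2 * D / \<delta>))"
    using assms mult_right_mono[OF of_nat_mono[OF card_length[of cs]], of "real CARD('n) * (2 * D / \<delta>)"]
    by simp
  ultimately show ?thesis by (simp add: mult.assoc)
qed

text \<open>In each coordinate the rounded value of a point of the ball is squeezed between those at
  \<open>c - D\<close> and \<open>c + D\<close>, which agree.\<close>

lemma grid_cell_eq_of_unsplit:
  fixes x y c s :: "real ^ 'n"
  assumes "\<delta> > 0" "s \<in> unsplit \<delta> D cs" "c \<in> set cs" "norm (x - c) \<le> D" "norm (y - c) \<le> D"
  shows "grid_cell \<delta> s x = grid_cell \<delta> s y"
proof -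
  have "\<lceil>(p $ i - s $ i) / \<delta> - 1 / 2\<rceil> = \<lceil>(c $ i - D - s $ i) / \<delta> - 1 / 2\<rceil>"
    if "norm (p - c) \<le> D" for p i
  proof -
    have "\<bar>p $ i - c $ i\<bar> \<le> D" using component_le_norm_cart[of "p - c" i] that by simp
    then have "(c $ i - D - s $ i) / \<delta> \<le> (p $ i - s $ i) / \<delta>"
      "(p $ i - s $ i) / \<delta> \<le> (c $ i + D - s $ i) / \<delta>"
      using assms(1) by (auto intro!: divide_right_mono)
    then have "\<lceil>(c $ i - D - s $ i) / \<delta> - 1 / 2\<rceil> \<le> \<lceil>(p $ i - s $ i) / \<delta> - 1 / 2\<rceil>"
      "\<lceil>(p $ i - s $ i) / \<delta> - 1 / 2\<rceil> \<le> \<lceil>(c $ i + D - s $ i) / \<delta> - 1 / 2\<rceil>"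
      by (auto intro!: ceiling_mono)
    moreover have "\<lceil>(c $ i - D - s $ i) / \<delta> - 1 / 2\<rceil> = \<lceil>(c $ i + D - s $ i) / \<delta> - 1 / 2\<rceil>"
      using assms(2,3) by (auto simp: unsplit_def straddle_def)
    ultimately show ?thesis by simp
  qed
  then show ?thesis using assms(4,5) by (simp add: grid_cell_def vec_eq_iff)
qed

section \<open>Measurability of the collision event\<close>

abbreviation length_law :: "nat \<Rightarrow> nat measure" where
  "length_law N \<equiv> uniform_count_measure {1..N}"

text \<open>With countably many values one argument can be fixed at a time, so any \<open>h\<close>
  is allowed.\<close>

lemma measurable_countable_binop:
  fixes f :: "'m \<Rightarrow> 'a::countable" and g :: "'m \<Rightarrow> 'b::countable"
  assumes "f \<in> M \<rightarrow>\<^sub>M count_space UNIV" "g \<in> M \<rightarrow>\<^sub>M count_space UNIV"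
  shows "(\<lambda>x. h (f x) (g x)) \<in> M \<rightarrow>\<^sub>M count_space UNIV"
proof (rule measurable_compose_countable[OF _ assms(1)])
  fix a show "(\<lambda>x. h a (g x)) \<in> M \<rightarrow>\<^sub>M count_space UNIV"
    by (rule measurable_compose[OF assms(2)]) simp
qed

lemma measurable_breakpoint:
  "(\<lambda>\<rho>. breakpoint \<rho> m i) \<in> (\<Pi>\<^sub>M k\<in>UNIV. length_law N) \<rightarrow>\<^sub>M count_space UNIV"
proof -
  have comp: "(\<lambda>\<rho>. \<rho> k) \<in> (\<Pi>\<^sub>M k\<in>UNIV. length_law N) \<rightarrow>\<^sub>M count_space UNIV" for k
  proof (rule measurable_compose[OF measurable_component_singleton[OF UNIV_I]])
    show "(\<lambda>x. x) \<in> length_law N \<rightarrow>\<^sub>M count_space UNIV"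
      by (auto simp: measurable_def sets_uniform_count_measure space_uniform_count_measure)
  qed
  have "(\<lambda>\<rho>. sum \<rho> {..<i}) \<in> (\<Pi>\<^sub>M k\<in>UNIV. length_law N) \<rightarrow>\<^sub>M count_space UNIV"
  proof (induction i)
    case (Suc i)
    then show ?case
      using measurable_countable_binop[OF Suc comp, of "(+)" i] by simp
  qed simp
  then show ?thesis
    unfolding breakpoint_def by (rule measurable_compose) simp
qed

lemma measurable_num_pieces:
  "(\<lambda>\<rho>. num_pieces \<rho> m) \<in> (\<Pi>\<^sub>M k\<in>UNIV. length_law N) \<rightarrow>\<^sub>M count_space UNIV"
  unfolding num_pieces_def
  by (rule measurable_Least) (rule measurable_compose[OF measurable_breakpoint], simp)

lemma measurable_grid_cell:
  "(\<lambda>t. grid_cell \<delta> t p) \<in> borel \<rightarrow>\<^sub>M (count_space UNIV :: (int ^ 'n) measure)"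
proof (subst measurable_count_space_eq2_countable, safe)
  fix z :: "int ^ 'n"
  have "(\<lambda>t. grid_cell \<delta> t p) -` {z} \<inter> space borel =
      (\<Inter>i. {t \<in> space borel. \<lceil>(p $ i - t $ i) / \<delta> - 1 / 2\<rceil> = z $ i})"
    by (auto simp: grid_cell_def vec_eq_iff)
  moreover have "{t \<in> space borel. \<lceil>(p $ i - t $ i) / \<delta> - 1 / 2\<rceil> = z $ i} \<in> sets borel" for i
  proof -
    note borel_measurable_component[of i, measurable]
    show ?thesis by measurable
  qed
  ultimately show "(\<lambda>t. grid_cell \<delta> t p) -` {z} \<inter> space borel \<in> sets borel"
    by (simp add: sets.finite_INT)
qed simp

text \<open>Once the values of the two breakpoints are fixed, and there are countably many, the
  piece is a fixed list and only the shift varies.\<close>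

lemma measurable_piece_cells:
  fixes P :: "(real ^ 'n) list"
  assumes "\<And>i. (\<lambda>x. breakpoint (\<rho> x) (length P) i) \<in> M \<rightarrow>\<^sub>M count_space UNIV"
    and "T \<in> M \<rightarrow>\<^sub>M borel"
  shows "(\<lambda>x. remdups_adj (map (grid_cell \<delta> (T x)) (piece (\<rho> x) P i))) \<in> M \<rightarrow>\<^sub>M count_space UNIV"
proof -
  let ?b = "\<lambda>i x. breakpoint (\<rho> x) (length P) i"
  have cells: "(\<lambda>x. map (grid_cell \<delta> (T x)) L) \<in> M \<rightarrow>\<^sub>M count_space UNIV" for L
  proof (induction L)
    case (Cons p L)
    show ?case
      using measurable_countable_binop[OF measurable_compose[OF assms(2) measurable_grid_cell] Cons, of "(#)"]
      by simp
  qed simp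
  show ?thesis
    unfolding piece_conv_take_drop
  proof (rule measurable_compose_countable[OF _ assms(1)[of i]])
    fix a
    show "(\<lambda>x. remdups_adj (map (grid_cell \<delta> (T x)) (take (?b (Suc i) x - a) (drop a P))))
        \<in> M \<rightarrow>\<^sub>M count_space UNIV"
      by (rule measurable_compose_countable[OF _ assms(1)[of "Suc i"]])
        (rule measurable_compose[OF cells], simp)
  qed
qed

lemma scheme_space_eq:
  "scheme_space \<delta> w l = (\<Pi>\<^sub>M k\<in>UNIV. shift_law \<delta>) \<Otimes>\<^sub>M
     (\<Pi>\<^sub>M k\<in>UNIV. length_law (w * l)) \<Otimes>\<^sub>M (\<Pi>\<^sub>M k\<in>UNIV. length_law (w * l))"
  by (simp add: scheme_space_def shift_cube_def)

lemma prob_space_scheme_space: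
  assumes "\<delta> > 0" "w * l \<ge> 1"
  shows "prob_space (scheme_space \<delta> w l :: ((nat \<Rightarrow> real ^ 'n) \<times> _) measure)"
proof -
  have S: "prob_space (\<Pi>\<^sub>M k\<in>UNIV. shift_law \<delta> :: (nat \<Rightarrow> real ^ 'n) measure)"
    by (rule prob_space_PiM[OF prob_space_shift_law[OF assms(1)]])
  have L: "prob_space (\<Pi>\<^sub>M k\<in>(UNIV::nat set). length_law (w * l))"
    by (rule prob_space_PiM[OF prob_space_uniform_count_measure]) (use assms(2) in auto)
  show ?thesis unfolding scheme_space_eq by (intro prob_space_pair S L)
qed

lemma space_scheme_space:
  "(t, \<rho>, \<sigma>) \<in> space (scheme_space \<delta> w l) \<longleftrightarrow>
     (\<forall>i. \<rho> i \<in> {1..w * l}) \<and> (\<forall>i. \<sigma> i \<in> {1..w * l})"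
  by (auto simp: scheme_space_eq space_pair_measure space_PiM space_uniform_count_measure PiE_UNIV_domain)

text \<open>The lower bound is obtained by including a product event in the collision event, and
  monotonicity of the measure requires the larger event to be measurable.\<close>

lemma collision_measurable:
  fixes P Q :: "(real ^ 'n::{finite, linorder}) list"
  assumes "\<delta> > 0"
  shows "{(t, \<rho>, \<sigma>) \<in> space (scheme_space \<delta> w l).
    speed_hash \<delta> t \<rho> P = speed_hash \<delta> t \<sigma> Q} \<in> sets (scheme_space \<delta> w l)"
proof -
  define M where "M = (scheme_space \<delta> w l :: ((nat \<Rightarrow> real ^ 'n::{finite, linorder}) \<times> (nat \<Rightarrow> nat) \<times> (nat \<Rightarrow> nat)) measure)"
  have "(\<lambda>x. fst x k) \<in> M \<rightarrow>\<^sub>M shift_law \<delta>" for k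
    unfolding M_def scheme_space_eq
    by (rule measurable_compose[OF measurable_fst measurable_component_singleton]) simp
  then have t: "(\<lambda>x. fst x k) \<in> M \<rightarrow>\<^sub>M borel" for k
    by (simp cong: measurable_cong_sets)
  have rP: "(\<lambda>x. fst (snd x)) \<in> M \<rightarrow>\<^sub>M (\<Pi>\<^sub>M k\<in>UNIV. length_law (w * l))"
    and rQ: "(\<lambda>x. snd (snd x)) \<in> M \<rightarrow>\<^sub>M (\<Pi>\<^sub>M k\<in>UNIV. length_law (w * l))"
    unfolding M_def scheme_space_eq by measurable
  let ?K = "\<lambda>x. num_pieces (fst (snd x)) (length P)" and ?L = "\<lambda>x. num_pieces (snd (snd x)) (length Q)"
  let ?c = "\<lambda>i x. remdups_adj (map (grid_cell \<delta> (fst x i)) (piece (fst (snd x)) P i))"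
  let ?d = "\<lambda>i x. remdups_adj (map (grid_cell \<delta> (fst x i)) (piece (snd (snd x)) Q i))"
  have K: "?K \<in> M \<rightarrow>\<^sub>M count_space UNIV" and L: "?L \<in> M \<rightarrow>\<^sub>M count_space UNIV"
    by (rule measurable_compose[OF rP measurable_num_pieces] measurable_compose[OF rQ measurable_num_pieces])+
  have c: "?c i \<in> M \<rightarrow>\<^sub>M count_space UNIV" for i
    by (rule measurable_piece_cells[OF measurable_compose[OF rP measurable_breakpoint] t])
  have d: "?d i \<in> M \<rightarrow>\<^sub>M count_space UNIV" for i
    by (rule measurable_piece_cells[OF measurable_compose[OF rQ measurable_breakpoint] t])
  have eq: "Measurable.pred M (\<lambda>x. ?K x = ?L x)" "Measurable.pred M (\<lambda>x. ?c i x = ?d i x)"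
    "Measurable.pred M (\<lambda>x. i < ?K x)" for i
    by (rule measurable_countable_binop[OF K L] measurable_countable_binop[OF c d]
        measurable_compose[OF K], simp?)+
  \<comment> \<open>The random range of \<open>i\<close> is written as an implication, so that the
    quantifier is a countable conjunction.\<close>
  have "Measurable.pred M (\<lambda>x. ?K x = ?L x \<and> (\<forall>i. i < ?K x \<longrightarrow> ?c i x = ?d i x))"
    using eq by measurable
  then have "{x \<in> space M. ?K x = ?L x \<and> (\<forall>i. i < ?K x \<longrightarrow> ?c i x = ?d i x)} \<in> sets M"
    by (simp add: pred_def)
  then show ?thesis
    by (simp add: speed_hash_eq_iff[OF assms] case_prod_unfold M_def)
qed

section \<open>Probabilities of product events\<close>

lemma measure_PiM_initial:
  assumes "prob_space N" "\<And>k. k < K \<Longrightarrow> X k \<in> sets N"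
  shows "{x \<in> space (\<Pi>\<^sub>M k\<in>(UNIV::nat set). N). \<forall>k<K. x k \<in> X k} \<in> sets (\<Pi>\<^sub>M k\<in>(UNIV::nat set). N)"
    and "measure (\<Pi>\<^sub>M k\<in>(UNIV::nat set). N) {x \<in> space (\<Pi>\<^sub>M k\<in>(UNIV::nat set). N). \<forall>k<K. x k \<in> X k} =
      (\<Prod>k<K. measure N (X k))"
proof -
  interpret N: prob_space N by fact
  interpret product_prob_space "\<lambda>_::nat. N" UNIV by (rule product_prob_spaceI) fact
  have eq: "{x \<in> space (\<Pi>\<^sub>M k\<in>(UNIV::nat set). N). \<forall>k<K. x k \<in> X k} =
      prod_emb UNIV (\<lambda>_. N) {..<K} (Pi\<^sub>E {..<K} X)"
    using assms(2) by (auto simp: prod_emb_def space_PiM PiE_iff)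
  show "{x \<in> space (\<Pi>\<^sub>M k\<in>(UNIV::nat set). N). \<forall>k<K. x k \<in> X k} \<in> sets (\<Pi>\<^sub>M k\<in>(UNIV::nat set). N)"
    unfolding eq by (rule sets_PiM_I) (use assms(2) in auto)
  show "measure (\<Pi>\<^sub>M k\<in>(UNIV::nat set). N) {x \<in> space (\<Pi>\<^sub>M k\<in>(UNIV::nat set). N). \<forall>k<K. x k \<in> X k} =
      (\<Prod>k<K. measure N (X k))"
    unfolding eq by (rule measure_PiM_emb) (use assms(2) in auto)
qed

lemma measure_pair_Times:
  assumes "prob_space N" "A \<in> sets M" "B \<in> sets N"
  shows "measure (M \<Otimes>\<^sub>M N) (A \<times> B) = measure M A * measure N B"
proof -
  interpret prob_space N by fact
  show ?thesis
    using assms by (simp add: measure_def emeasure_pair_measure_Times enn2real_mult)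
qed

text \<open>Independence, with the factors regrouped by index so that each chunk contributes one
  shift and two lengths.\<close>

lemma measure_scheme_rectangle:
  fixes A :: "nat \<Rightarrow> (real ^ 'n) set"
  assumes "\<delta> > 0" "w * l \<ge> 1"
    and "\<And>k. k < K \<Longrightarrow> A k \<in> sets borel" "\<And>k. k < K \<Longrightarrow> B k \<subseteq> {1..w * l}"
      "\<And>k. k < K \<Longrightarrow> C k \<subseteq> {1..w * l}"
  shows "measure (scheme_space \<delta> w l) {(t, \<rho>, \<sigma>). (t, \<rho>, \<sigma>) \<in> space (scheme_space \<delta> w l) \<and>
      (\<forall>k<K. t k \<in> A k) \<and> (\<forall>k<K. \<rho> k \<in> B k) \<and> (\<forall>k<K. \<sigma> k \<in> C k)} =
      (\<Prod>k<K. measure (shift_law \<delta>) (A k) * (real (card (B k)) / real (w * l)) *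
        (real (card (C k)) / real (w * l)))"
proof -
  let ?S = "\<Pi>\<^sub>M k\<in>(UNIV::nat set). (shift_law \<delta> :: (real ^ 'n) measure)"
  let ?L = "\<Pi>\<^sub>M k\<in>(UNIV::nat set). length_law (w * l)"
  have pS: "prob_space (shift_law \<delta> :: (real ^ 'n) measure)" by (rule prob_space_shift_law[OF assms(1)])
  have pL: "prob_space (length_law (w * l))" by (rule prob_space_uniform_count_measure) (use assms(2) in auto)
  have pP: "prob_space ?L" by (rule prob_space_PiM[OF pL])
  interpret L: prob_space ?L by (rule pP)
  interpret LL: pair_prob_space ?L ?L ..
  let ?A = "{t \<in> space ?S. \<forall>k<K. t k \<in> A k}"
  let ?R = "\<lambda>B. {\<rho> \<in> space ?L. \<forall>k<K. \<rho> k \<in> B k}"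
  have A: "?A \<in> sets ?S" "measure ?S ?A = (\<Prod>k<K. measure (shift_law \<delta>) (A k))"
    using measure_PiM_initial[OF pS, of K A] assms(3) by simp_all
  have R: "?R B \<in> sets ?L" "measure ?L (?R B) = (\<Prod>k<K. real (card (B k)) / real (w * l))"
    if "\<And>k. k < K \<Longrightarrow> B k \<subseteq> {1..w * l}" for B
  proof -
    have B: "B k \<in> sets (length_law (w * l))" if "k < K" for k
      using \<open>\<And>k. k < K \<Longrightarrow> B k \<subseteq> {1..w * l}\<close>[OF that] by (simp add: sets_uniform_count_measure)
    show "?R B \<in> sets ?L" by (rule measure_PiM_initial(1)[OF pL B])
    have "measure ?L (?R B) = (\<Prod>k<K. measure (length_law (w * l)) (B k))"
      by (rule measure_PiM_initial(2)[OF pL B])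
    also have "\<dots> = (\<Prod>k<K. real (card (B k)) / real (w * l))"
      using that by (intro prod.cong refl) (simp add: measure_uniform_count_measure)
    finally show "measure ?L (?R B) = (\<Prod>k<K. real (card (B k)) / real (w * l))" .
  qed
  have eq: "{(t, \<rho>, \<sigma>). (t, \<rho>, \<sigma>) \<in> space (scheme_space \<delta> w l) \<and>
      (\<forall>k<K. t k \<in> A k) \<and> (\<forall>k<K. \<rho> k \<in> B k) \<and> (\<forall>k<K. \<sigma> k \<in> C k)} = ?A \<times> (?R B \<times> ?R C)"
    by (auto simp: scheme_space_eq space_pair_measure)
  show "measure (scheme_space \<delta> w l) {(t, \<rho>, \<sigma>). (t, \<rho>, \<sigma>) \<in> space (scheme_space \<delta> w l) \<and>
      (\<forall>k<K. t k \<in> A k) \<and> (\<forall>k<K. \<rho> k \<in> B k) \<and> (\<forall>k<K. \<sigma> k \<in> C k)} =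
      (\<Prod>k<K. measure (shift_law \<delta>) (A k) * (real (card (B k)) / real (w * l)) *
        (real (card (C k)) / real (w * l)))"
  proof -
    have BC: "?R B \<in> sets ?L" "?R C \<in> sets ?L" using R(1) assms(4,5) by blast+
    have mB: "measure ?L (?R B) = (\<Prod>k<K. real (card (B k)) / real (w * l))"
      by (rule R(2)) (rule assms(4))
    have mC: "measure ?L (?R C) = (\<Prod>k<K. real (card (C k)) / real (w * l))"
      by (rule R(2)) (rule assms(5))
    have "measure (?S \<Otimes>\<^sub>M ?L \<Otimes>\<^sub>M ?L) (?A \<times> (?R B \<times> ?R C)) =
        measure ?S ?A * (measure ?L (?R B) * measure ?L (?R C))"
      using measure_pair_Times[OF LL.prob_space_axioms A(1) pair_measureI[OF BC]]
        measure_pair_Times[OF pP BC] by simp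
    then show ?thesis
      unfolding eq unfolding scheme_space_eq A(2) mB mC
      by (simp only: prod.distrib mult.assoc)
  qed
qed

section \<open>Collision probability\<close>

text \<open>Weighted arithmetic-geometric mean of 1 and \<open>y\<close>, obtained from convexity of
  \<open>exp\<close> between 0 and \<open>ln y\<close>.\<close>

lemma powr_le_weighted_mean:
  fixes x y :: real
  assumes "0 < y" "0 \<le> x" "x \<le> 1"
  shows "y powr x \<le> 1 - x + x * y"
proof -
  have "exp ((1 - x) *\<^sub>R 0 + x *\<^sub>R ln y) \<le> (1 - x) * exp 0 + x * exp (ln y)"
    using assms by (intro convex_onD[OF exp_convex]) auto
  then show ?thesis using assms by (simp add: powr_def)
qed

text \<open>A chunk with prescribed length has exponent 1 and one good value out of
  \<open>w * l\<close>. Otherwise every length from \<open>a\<close> on is good, and the weighted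
  mean inequality applies with \<open>x = s / l\<close>.\<close>

lemma prob_length_choice_ge:
  fixes w l s a :: nat
  assumes "w \<ge> 1" "l \<ge> 1" "s \<le> l" "1 \<le> a" "a \<le> w * s" "full \<Longrightarrow> s = l"
  shows "(1 / real (w * l)) powr (real s / real l)
    \<le> real (card (if full then {a} else {a..w * l})) / real (w * l)"
proof (cases full)
  case True
  then show ?thesis using assms by simp
next
  case False
  define x where "x = real s / real l"
  have N: "real (w * l) \<ge> 1" using assms(1,2) by (metis mult_le_mono nat_mult_1 of_nat_1 of_nat_le_iff)
  have x: "0 \<le> x" "x \<le> 1" using assms(2,3) by (auto simp: x_def)
  have "a \<le> w * l" using assms(3,5) by (meson le_trans mult_le_mono2)
  then have card: "real (card {a..w * l}) = real (w * l) - real a + 1"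
    by simp
  have "(1 / real (w * l)) powr x \<le> 1 - x + x * (1 / real (w * l))"
    using x N by (intro powr_le_weighted_mean) auto
  also have "\<dots> \<le> 1 - x + 1 / real (w * l)"
    using x N by (simp add: mult_left_le_one_le divide_right_mono)
  \<comment> \<open>Here \<open>x\<close> is rewritten as \<open>w * s / (w * l)\<close>, where
    \<open>w * s\<close> bounds \<open>a\<close>.\<close>
  also have "\<dots> = (real (w * l) - real (w * s) + 1) / real (w * l)"
    using assms(1,2) by (simp add: x_def field_simps)
  also have "\<dots> \<le> (real (w * l) - real a + 1) / real (w * l)"
    using assms(5) N by (intro divide_right_mono) (auto simp flip: of_nat_mult)
  finally show ?thesis using False card by (simp add: x_def)
qed

text \<open>The base factors as \<open>1 / 2\<close> for the shift and \<open>1 / N\<close> for each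
  of the two lengths. The shift factor is strict because
  \<open>(1 / 2) powr x \<le> 1 - x / 2 < p\<close>.\<close>

lemma chunk_prob_gt:
  fixes w l s :: nat and p u v N :: real
  assumes "w \<ge> 1" "l \<ge> 1" "s \<le> l"
    and "p > 1 - real s / (2 * real l)" "N = real (w * l)"
    and "(1 / N) powr (real s / real l) \<le> u" "(1 / N) powr (real s / real l) \<le> v"
  shows "(1 / (2 * N\<^sup>2)) powr (real s / real l) < p * u * v"
proof -
  define x where "x = real s / real l"
  have x: "0 \<le> x" "x \<le> 1" using assms(2,3) by (auto simp: x_def)
  have "N > 0" using assms(1,2,5) by simp
  have "1 / (2 * N\<^sup>2) = 1 / 2 * (1 / N) * (1 / N)" by (simp add: power2_eq_square)
  then have eq: "(1 / (2 * N\<^sup>2)) powr x = (1 / 2) powr x * (1 / N) powr x * (1 / N) powr x"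
    using \<open>N > 0\<close> by (simp only: powr_mult)
  have pos: "0 < (1 / 2) powr x" "0 < (1 / N) powr x" using \<open>N > 0\<close> by auto
  have "(1 / 2) powr x \<le> 1 - x + x * (1 / 2)" using x by (intro powr_le_weighted_mean) auto
  also have "\<dots> < p" using assms(4) by (simp add: x_def)
  finally have p: "(1 / 2) powr x < p" .
  have uv: "(1 / N) powr x \<le> u" "(1 / N) powr x \<le> v" using assms(6,7) by (simp_all add: x_def)
  have "(1 / 2) powr x * (1 / N) powr x * (1 / N) powr x < p * (1 / N) powr x * (1 / N) powr x"
    using p pos by simp
  also have "\<dots> \<le> p * u * v"
  proof (intro mult_mono uv)
    have "0 \<le> p" "0 \<le> u" using p uv pos by linarith+
    then show "0 \<le> p" "0 \<le> p * u" by simp_all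
  qed (use pos in auto)
  finally show ?thesis unfolding eq x_def[symmetric] .
qed

lemma concat_map_concat: "concat (map (\<lambda>c. concat (map f c)) cs) = concat (map f (concat cs))"
  by (induction cs) auto

text \<open>Chunk \<open>k\<close> of the stars is made piece \<open>k\<close> of both curves.
  Suitable lengths cut the curves there and an unsplit shift makes each star constant, so both
  pieces hash alike.\<close>

lemma collision_prob_gt:
  fixes P Q :: "(real ^ 'n::{finite, linorder}) list"
  assumes "concat (map fst ss) = P" "concat (map snd ss) = Q" "\<forall>s \<in> set ss. star w D s" "ss \<noteq> []"
    and "0 \<le> D" "D < r" "w \<ge> 1" "l \<ge> 1" "\<delta> = 4 * real CARD('n) * r * real l"
  shows "(1 / (2 * (real (w * l))\<^sup>2)) powr (real (length ss) / real l)
    < \<P>((t, \<rho>, \<sigma>) in scheme_space \<delta> w l. speed_hash \<delta> t \<rho> P = speed_hash \<delta> t \<sigma> Q)"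
proof -
  have "1 \<le> real CARD('n)" "1 \<le> real l" "r > 0" using assms by (simp_all add: Suc_le_eq)
  have \<delta>: "\<delta> > 0" using assms \<open>r > 0\<close> by simp
  have "r * 1 \<le> r * (real CARD('n) * real l)"
    using \<open>1 \<le> real CARD('n)\<close> \<open>1 \<le> real l\<close> \<open>r > 0\<close>
    by (intro mult_left_mono) (metis mult_mono mult_1 order.trans zero_le_one of_nat_0_le_iff, simp)
  then have "2 * D \<le> 4 * (r * (real CARD('n) * real l))" using \<open>D < r\<close> \<open>r > 0\<close> by linarith
  then have D\<delta>: "2 * D \<le> \<delta>" using assms by (simp add: mult.commute mult.left_commute)
  have wl: "w * l \<ge> 1" using assms(7,8) by (simp add: Suc_le_eq)
  obtain cs where cs: "concat cs = ss" "cs \<noteq> []" "\<And>c. c \<in> set cs \<Longrightarrow> c \<noteq> [] \<and> length c \<le> l"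
      "\<And>k. k < length cs - 1 \<Longrightarrow> length (cs ! k) = l"
    using chunks_exist[OF \<open>l \<ge> 1\<close> \<open>ss \<noteq> []\<close>] by blast
  define K where "K = length cs"
  have "K > 0" using cs(2) by (simp add: K_def)
  have csk: "cs ! k \<in> set cs" "set (cs ! k) \<subseteq> set ss" if "k < K" for k
  proof -
    show "cs ! k \<in> set cs" using that by (simp add: K_def)
    then show "set (cs ! k) \<subseteq> set ss" unfolding cs(1)[symmetric] set_concat by blast
  qed
  have "\<forall>s \<in> set ss. \<exists>c. \<forall>x \<in> set (fst s) \<union> set (snd s). norm (x - c) \<le> D"
    using assms(3) by (auto simp: star_def)
  then obtain cen where cen: "\<forall>s \<in> set ss. \<forall>x \<in> set (fst s) \<union> set (snd s). norm (x - cen s) \<le> D"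
    by (auto dest!: bchoice)
  define As where "As = map (\<lambda>c. concat (map fst c)) cs"
  define Bs where "Bs = map (\<lambda>c. concat (map snd c)) cs"
  have PQ: "concat As = P" "concat Bs = Q"
    using cs(1) assms(1,2) by (simp_all add: As_def Bs_def concat_map_concat)
  have len: "length As = K" "length Bs = K" by (simp_all add: As_def Bs_def K_def)
  have ne: "As \<noteq> []" "Bs \<noteq> []" using len \<open>K > 0\<close> by auto
  have nth: "As ! k = concat (map fst (cs ! k))" "Bs ! k = concat (map snd (cs ! k))" if "k < K" for k
    using that by (simp_all add: As_def Bs_def K_def)
  have sizes: "1 \<le> length (As ! k)" "length (As ! k) \<le> w * length (cs ! k)"
      "1 \<le> length (Bs ! k)" "length (Bs ! k) \<le> w * length (cs ! k)" if k: "k < K" for k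
  proof -
    have st: "\<forall>s \<in> set (cs ! k). star w D s" using csk(2)[OF k] assms(3) by blast
    have "1 \<le> length (cs ! k)" using cs(3)[OF csk(1)[OF k]] by (simp add: Suc_le_eq)
    moreover have "length (map fst (cs ! k)) \<le> length (As ! k)" "length (map snd (cs ! k)) \<le> length (Bs ! k)"
      unfolding nth[OF k] using st by (intro length_le_length_concat; auto simp: star_def)+
    moreover have "length (As ! k) \<le> w * length (map fst (cs ! k))"
        "length (Bs ! k) \<le> w * length (map snd (cs ! k))"
      unfolding nth[OF k] using st by (intro length_concat_le; auto simp: star_def)+
    ultimately show "1 \<le> length (As ! k)" "length (As ! k) \<le> w * length (cs ! k)"
      "1 \<le> length (Bs ! k)" "length (Bs ! k) \<le> w * length (cs ! k)"
      by simp_all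
  qed
  have csl: "length (cs ! k) \<le> l" if "k < K" for k using cs(3) csk(1)[OF that] by blast
  \<comment> \<open>Good lengths for a chunk with \<open>a\<close> vertices on the curve concerned:
    exact, except that the last piece may be longer.\<close>
  define I where "I a k = (if k < K - 1 then {a} else {a..w * l})" for a k :: nat
  have I_sub: "I a k \<subseteq> {1..w * l}" if "k < K" "1 \<le> a" "a \<le> w * length (cs ! k)" for a k
  proof -
    have "a \<le> w * l" using that(3) mult_le_mono2[OF csl[OF that(1)]] by (rule order_trans)
    then show ?thesis using that(2) by (auto simp: I_def)
  qed
  have I_prob: "(1 / real (w * l)) powr (real (length (cs ! k)) / real l) \<le> real (card (I a k)) / real (w * l)"
    if "k < K" "1 \<le> a" "a \<le> w * length (cs ! k)" for a k
    unfolding I_def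
    by (rule prob_length_choice_ge) (use assms(7,8) csl that cs(4) in \<open>auto simp: K_def\<close>)
  let ?A = "\<lambda>k. unsplit \<delta> D (map cen (cs ! k))"
  let ?E = "{(t, \<rho>, \<sigma>). (t, \<rho>, \<sigma>) \<in> space (scheme_space \<delta> w l) \<and> (\<forall>k<K. t k \<in> ?A k) \<and>
      (\<forall>k<K. \<rho> k \<in> I (length (As ! k)) k) \<and> (\<forall>k<K. \<sigma> k \<in> I (length (Bs ! k)) k)}"
  let ?q = "1 / (2 * (real (w * l))\<^sup>2)"
  have "?q powr (real (length ss) / real l) = ?q powr (\<Sum>k<K. real (length (cs ! k)) / real l)"
  proof -
    have "length ss = (\<Sum>k<K. length (cs ! k))"
      unfolding cs(1)[symmetric] length_concat K_def
      by (simp add: sum_list_sum_nth atLeast0LessThan)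
    then show ?thesis by (simp add: sum_divide_distrib)
  qed
  also have "\<dots> = (\<Prod>k<K. ?q powr (real (length (cs ! k)) / real l))"
    using assms(7,8) by (intro powr_sum) auto
  also have "\<dots> < (\<Prod>k<K. measure (shift_law \<delta>) (?A k) * (real (card (I (length (As ! k)) k)) / real (w * l)) *
      (real (card (I (length (Bs ! k)) k)) / real (w * l)))"
  proof -
    have less: "?q powr (real (length (cs ! k)) / real l) <
        measure (shift_law \<delta>) (?A k) * (real (card (I (length (As ! k)) k)) / real (w * l)) *
        (real (card (I (length (Bs ! k)) k)) / real (w * l))" if k: "k < K" for k
    proof (rule chunk_prob_gt)
      have "real (length (cs ! k)) > 0" using cs(3) csk(1)[OF k] by simp
      \<comment> \<open>By the choice of \<open>\<delta>\<close> the left side is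
        \<open>D / (2 * r * l)\<close>, and \<open>D < r\<close>.\<close>
      moreover have "real CARD('n) * (2 * D / \<delta>) < 1 / (2 * real l)"
        using assms \<open>r > 0\<close> \<open>1 \<le> real l\<close> by (simp add: field_simps)
      ultimately have "real (length (cs ! k)) * (real CARD('n) * (2 * D / \<delta>))
          < real (length (cs ! k)) * (1 / (2 * real l))"
        by (simp only: mult_less_cancel_left_pos)
      then show "1 - real (length (cs ! k)) / (2 * real l) < measure (shift_law \<delta>) (?A k)"
        using prob_unsplit_ge[OF \<delta> \<open>0 \<le> D\<close> D\<delta>, of "map cen (cs ! k)"] by (simp add: mult.assoc)
    qed (use assms(7,8) csl[OF k] I_prob[OF k] sizes[OF k] in auto)
    \<comment> \<open>Every factor is strictly larger and \<open>K > 0\<close>, so the product is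
      strictly larger.\<close>
    show ?thesis
    proof (rule prod_mono_strict)
      show "0 \<in> {..<K}" using \<open>K > 0\<close> by simp
    qed (use less \<open>K > 0\<close> in \<open>auto intro: less_imp_le order.strict_trans1[OF powr_ge_zero]\<close>)
  qed
  also have "\<dots> = measure (scheme_space \<delta> w l) ?E"
    by (rule measure_scheme_rectangle[symmetric])
      (use \<delta> wl unsplit_borel I_sub sizes in auto)
  also have "\<dots> \<le> \<P>((t, \<rho>, \<sigma>) in scheme_space \<delta> w l. speed_hash \<delta> t \<rho> P = speed_hash \<delta> t \<sigma> Q)"
  proof -
    interpret prob_space "scheme_space \<delta> w l :: ((nat \<Rightarrow> real ^ 'n::{finite, linorder}) \<times> _) measure"
      by (rule prob_space_scheme_space[OF \<delta> wl])
    show ?thesis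
    proof (rule finite_measure_mono[OF subsetI collision_measurable[OF \<delta>]])
      fix x assume "x \<in> ?E"
      then obtain t \<rho> \<sigma> where x: "x = (t, \<rho>, \<sigma>)"
        and sp: "(t, \<rho>, \<sigma>) \<in> space (scheme_space \<delta> w l)"
        and t: "\<forall>k<K. t k \<in> ?A k" and \<rho>: "\<forall>k<K. \<rho> k \<in> I (length (As ! k)) k"
        and \<sigma>: "\<forall>k<K. \<sigma> k \<in> I (length (Bs ! k)) k"
        by auto
      have pieces: "num_pieces \<tau> (length (concat Cs)) = K \<and> (\<forall>k<K. piece \<tau> (concat Cs) k = Cs ! k)"
        if Cs: "length Cs = K" "\<And>k. k < K \<Longrightarrow> 1 \<le> length (Cs ! k)" "\<forall>k<K. \<tau> k \<in> I (length (Cs ! k)) k" for \<tau> Cs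
      proof -
        have 1: "Cs \<noteq> []" using Cs(1) \<open>K > 0\<close> by auto
        have 2: "\<forall>p \<in> set Cs. p \<noteq> []" using Cs(1,2) by (fastforce simp: in_set_conv_nth)
        have 3: "\<tau> k = length (Cs ! k)" if "k < length Cs - 1" for k
          using Cs(3)[rule_format, of k] that Cs(1) by (simp add: I_def)
        have 4: "length (last Cs) \<le> \<tau> (length Cs - 1)"
          using Cs(3)[rule_format, of "K - 1"] \<open>K > 0\<close> Cs(1) by (simp add: I_def last_conv_nth[OF 1])
        show ?thesis using pieces_eq[where \<rho> = \<tau>, OF 1 2 3 4] Cs(1) by simp
      qed
      have P: "num_pieces \<rho> (length P) = K" "\<forall>k<K. piece \<rho> P k = As ! k"
        and Q: "num_pieces \<sigma> (length Q) = K" "\<forall>k<K. piece \<sigma> Q k = Bs ! k"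
        using pieces[of As \<rho>] pieces[of Bs \<sigma>] len sizes \<rho> \<sigma> PQ by simp_all
      have "remdups_adj (map (grid_cell \<delta> (t k)) (As ! k)) = remdups_adj (map (grid_cell \<delta> (t k)) (Bs ! k))"
        if k: "k < K" for k
        unfolding nth[OF k]
      proof (rule remdups_adj_concat_blocks, clarify)
        fix A B assume AB: "(A, B) \<in> set (cs ! k)"
        then have ss: "(A, B) \<in> set ss" using csk(2)[OF k] by blast
        then have "A \<noteq> []" "B \<noteq> []" using assms(3) by (auto simp: star_def)
        moreover have "grid_cell \<delta> (t k) x = grid_cell \<delta> (t k) (hd A)" if "x \<in> set A \<union> set B" for x
        proof (rule grid_cell_eq_of_unsplit[OF \<delta>])
          show "t k \<in> ?A k" using t k by blast
          show "cen (A, B) \<in> set (map cen (cs ! k))" using AB by force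
          show "norm (x - cen (A, B)) \<le> D" "norm (hd A - cen (A, B)) \<le> D"
            using cen ss that \<open>A \<noteq> []\<close> by fastforce+
        qed
        ultimately show "A \<noteq> [] \<and> B \<noteq> [] \<and> (\<exists>v. \<forall>x \<in> set A \<union> set B. grid_cell \<delta> (t k) x = v)"
          by blast
      qed
      then have "speed_hash \<delta> t \<rho> P = speed_hash \<delta> t \<sigma> Q"
        using P Q by (simp add: speed_hash_eq_iff[OF \<delta>])
      with sp x show "x \<in> {(t, \<rho>, \<sigma>) \<in> space (scheme_space \<delta> w l).
          speed_hash \<delta> t \<rho> P = speed_hash \<delta> t \<sigma> Q}"
        by simp
    qed
  qed
  finally show ?thesis .
qed

theorem theorem17:
  fixes P Q :: "(real ^ 'n::{finite, linorder}) list"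
    and m w l :: nat and r \<delta> c :: real
  assumes "P \<noteq> []" and "Q \<noteq> []"
    and "m = min (length P) (length Q)"
    and "w \<ge> 1" and "l \<ge> 1" and "r > 0"
    and "\<delta> = 4 * real CARD('n) * r * real l"
    and "c = 4 * real CARD('n) powr (3 / 2) * real l"
  shows "(speed_compatible w P Q \<and> speed_frechet w P Q < r \<longrightarrow>
            \<P>((t, rP, rQ) in scheme_space \<delta> w l. speed_hash \<delta> t rP P = speed_hash \<delta> t rQ Q)
              > (1 / (sqrt 2 * real w * real l)) powr (2 * real m / real l)) \<and>
         (speed_compatible (w * l) P Q \<and> speed_frechet (w * l) P Q > c * r \<longrightarrow>
            \<P>((t, rP, rQ) in scheme_space \<delta> w l. speed_hash \<delta> t rP P = speed_hash \<delta> t rQ Q)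
              = 0)"
proof (intro conjI impI; elim conjE)
  assume compat: "speed_compatible w P Q" and less: "speed_frechet w P Q < r"
  define D where "D = speed_frechet w P Q"
  obtain T where T: "speed_traversal w (length P) (length Q) T"
      "\<forall>(i, j) \<in> set T. norm (P ! i - Q ! j) \<le> D"
    using speed_frechet_attained[OF assms(1,2) compat \<open>w \<ge> 1\<close>] unfolding D_def by blast
  have "T \<noteq> []" using T(1) by (simp add: speed_traversal_def traversal_def)
  then have "0 \<le> D" using T(2) by (cases T) (auto intro: order_trans[OF norm_ge_zero])
  obtain ss where ss: "concat (map fst ss) = P" "concat (map snd ss) = Q" "\<forall>s \<in> set ss. star w D s"
    using speed_traversal_stars[OF T(1) assms(1,2) \<open>0 \<le> D\<close> T(2)] by blast
  have "ss \<noteq> []" using ss(1) assms(1) by auto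
  have "\<forall>s \<in> set ss. fst s \<noteq> [] \<and> snd s \<noteq> []" using ss(3) by (auto simp: star_def)
  \<comment> \<open>Each star uses up at least one vertex of either curve.\<close>
  then have "length ss \<le> length P" "length ss \<le> length Q"
    using length_le_length_concat[of "map fst ss"] length_le_length_concat[of "map snd ss"] ss
    by auto
  then have "length ss \<le> m" using assms(3) by simp
  define q where "q = 1 / (2 * (real (w * l))\<^sup>2)"
  have N: "1 \<le> (real (w * l))\<^sup>2"
    using assms(4,5) by (metis mult_le_mono nat_mult_1 of_nat_1 of_nat_le_iff one_le_power)
  have q: "0 \<le> q" "q \<le> 1" unfolding q_def using N by (auto simp: divide_le_eq)
  \<comment> \<open>The factor 2 in the exponent of the claim is absorbed by squaring the
    base.\<close>
  have "(1 / (sqrt 2 * real w * real l))\<^sup>2 = q"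
    by (simp add: q_def power_divide power_mult_distrib)
  then have "(1 / (sqrt 2 * real w * real l)) powr (2 * real m / real l) = q powr (real m / real l)"
    using assms(4,5) powr_powr[of "1 / (sqrt 2 * real w * real l)" 2 "real m / real l"] by simp
  \<comment> \<open>As \<open>q \<le> 1\<close>, a smaller exponent gives a larger power.\<close>
  also have "\<dots> \<le> q powr (real (length ss) / real l)"
    using q \<open>length ss \<le> m\<close> by (intro powr_mono') (auto simp: divide_right_mono)
  also have "\<dots> < \<P>((t, rP, rQ) in scheme_space \<delta> w l. speed_hash \<delta> t rP P = speed_hash \<delta> t rQ Q)"
    unfolding q_def
    by (rule collision_prob_gt[OF ss \<open>ss \<noteq> []\<close> \<open>0 \<le> D\<close> less[folded D_def] assms(4,5,7)])
  finally show "\<P>((t, rP, rQ) in scheme_space \<delta> w l. speed_hash \<delta> t rP P = speed_hash \<delta> t rQ Q)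
    > (1 / (sqrt 2 * real w * real l)) powr (2 * real m / real l)" .
next
  assume far: "speed_frechet (w * l) P Q > c * r"
  have \<delta>: "\<delta> > 0" using assms by simp
  \<comment> \<open>This splits \<open>c * r\<close> into the factor \<open>sqrt d\<close> of the
    cell diameter and the side length \<open>\<delta>\<close>.\<close>
  have "real CARD('n) powr (3 / 2) = real CARD('n) * sqrt (real CARD('n))"
    using powr_add[of "real CARD('n)" 1 "1 / 2"] by (simp add: powr_half_sqrt)
  then have cr: "sqrt (real CARD('n)) * \<delta> = c * r"
    using assms(7,8) by simp
  have "speed_hash \<delta> t \<rho> P \<noteq> speed_hash \<delta> t \<sigma> Q" if "(t, \<rho>, \<sigma>) \<in> space (scheme_space \<delta> w l)" for t \<rho> \<sigma>
    using speed_frechet_le_of_hash_eq[OF \<delta> assms(1,2), of \<rho> "w * l" \<sigma> t] that far cr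
    by (auto simp: space_scheme_space)
  then have "{(t, rP, rQ) \<in> space (scheme_space \<delta> w l).
      speed_hash \<delta> t rP P = speed_hash \<delta> t rQ Q} = {}"
    by auto
  then show "\<P>((t, rP, rQ) in scheme_space \<delta> w l. speed_hash \<delta> t rP P = speed_hash \<delta> t rQ Q) = 0"
    by (simp only: measure_empty)
qed

end
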